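(* Let $(\mathcal{J},\cdot,\alpha)$ be a finite-dimensional regular Hom-Jordan superalgebra, $(V,\pi,\beta)$ a finite-dimensional $\mathcal{J}$-module with $\beta$ invertible, and $T:V\to\mathcal{J}$ an even linear map such that $T\beta=\alpha T$. Let $\{u_1,\dots,u_p,v_1,\dots,v_q\}$ be a basis of $V$ with $u_i$ even and $v_s$ odd, with dual basis $\{u_i^*,v_s^*\}$ of $V^*$, and identify $T$ with the element $$T=\sum_{i=1}^{p}T(u_i)\otimes u_i^*+\sum_{s=1}^{q}T(v_s)\otimes v_s^*\in\mathcal{J}\otimes V^*\subset(\mathcal{J}\ltimes_{\pi^\star}V^* )^{\otimes2}.$$ Then $r=T-\sigma(T)$ is a super skew-symmetric solution of the super Hom-Jordan Yang-Baxter equation in the Hom-Jordan superalgebra $\mathcal{J}\ltimes_{\pi^\star}V^*$ if and only if $T$ is an $\mathcal{O}$-operator on $\mathcal{J}$ associated to $(V,\pi,\beta)$.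
   Context: $\mathbb{K}$ is an algebraically closed field of characteristic $0$; all spaces and linear maps are over $\mathbb{K}$. $|x|\in\mathbb{Z}_2$ is the parity of a homogeneous element $x$; identities involving parities are required for all homogeneous elements. A Hom-Jordan superalgebra is a triple $(\mathcal{J},\cdot,\alpha)$ with $\mathcal{J}$ a $\mathbb{Z}_2$-graded vector space, $\cdot:\mathcal{J}\times\mathcal{J}\to\mathcal{J}$ an even bilinear map with $x\cdot y=(-1)^{|x||y|}y\cdot x$, and $\alpha:\mathcal{J}\to\mathcal{J}$ an even linear map, such that for all homogeneous $x,y,z,u$ $$\sum_{x,y,u}(-1)^{|u|(|x|+|z|)}\,as_\alpha(x\cdot y,\alpha(z),\alpha(u))=0,$$ where $\sum_{x,y,u}$ is the cyclic sum over $(x,y,u)$ and $as_\alpha(x,y,z)=(x\cdot y)\cdot\alpha(z)-\alpha(x)\cdot(y\cdot z)$. All Hom-algebras are multiplicative: $\alpha(x\cdot y)=\alpha(x)\cdot\alpha(y)$; $\mathcal{J}$ is regular if $\alpha$ is moreover bijective. A $\mathcal{J}$-module (representation) on a $\mathbb{Z}_2$-graded vector space $V$ with respect to an even linear map $\beta:V\to V$, written $(V,\pi,\beta)$, is an even linear map $\pi:\mathcal{J}\to \mathrm{End}(V)$ such that for all homogeneous $x,y,z$, $\beta\pi(x)=\pi(\alpha(x))\beta$ and $$(-1)^{|x||z|}\pi(\alpha(x)\cdot\alpha(y))\pi(\alpha(z))\beta+(-1)^{|x||y|}\pi(\alpha(y)\cdot\alpha(z))\pi(\alpha(x))\beta+(-1)^{|y||z|}\pi(\alpha(z)\cdot\alpha(x))\pi(\alpha(y))\beta$$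 is equal to both of $$(-1)^{|x||z|}\pi(\alpha^2(x))\pi(y\cdot z)\beta+(-1)^{|x||y|}\pi(\alpha^2(y))\pi(z\cdot x)\beta+(-1)^{|y||z|}\pi(\alpha^2(z))\pi(x\cdot y)\beta$$ and $$(-1)^{|x||z|}\pi(\alpha^2(x))\pi(\alpha(y))\pi(z)+(-1)^{|x||y|+|y||z|}\pi(\alpha^2(z))\pi(\alpha(y))\pi(x)+(-1)^{|y||z|+|x||z|}\pi((x\cdot z)\cdot\alpha(y))\beta^2.$$ Dual module: $V^*$ has its natural grading and $\gamma^*(\xi)=\xi\circ\gamma$ for linear $\gamma:V\to V$. With $\langle\pi^*(x)(\xi),v\rangle=(-1)^{|x||\xi|}\langle\xi,\pi(x)v\rangle$, put $\pi^\star(x)(\xi)=\pi^*(\alpha(x))((\beta^{-2})^*(\xi))$; $(V^*,\pi^\star,(\beta^{-1})^* )$ is a $\mathcal{J}$-module. The semi-direct product $\mathcal{J}\ltimes_{\pi}V$ of $\mathcal{J}$ with a module $(V,\pi,\beta)$ is the Hom-Jordan superalgebra on $\mathcal{J}\oplus V$ with product, for homogeneous $x+u$, $y+v$ ($x,y\in\mathcal{J}$, $u,v\in V$, $|x|=|u|$, $|y|=|v|$), $(x+u)\cdot(y+v)=x\cdot y+\pi(x)(v)+(-1)^{|u||y|}\pi(y)(u)$ and twist map $x+u\mapsto\alpha(x)+\beta(u)$. In particular $\mathcal{J}\ltimes_{\pi^\star}V^*$ is built from $(V^*,\pi^\star,(\beta^{-1})^* )$ and has twist map $x+\xi\mapsto\alpha(x)+(\beta^{-1})^*(\xi)$.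 An $\mathcal{O}$-operator on $\mathcal{J}$ associated to $(V,\pi,\beta)$ is an even linear map $T:V\to\mathcal{J}$ with $\alpha T=T\beta$ and $T(u)\cdot T(v)=T\big(\pi(T(u))v+(-1)^{|u||v|}\pi(T(v))u\big)$ for all homogeneous $u,v\in V$. For a graded space $W$, $\sigma:W\otimes W\to W\otimes W$ is $\sigma(x\otimes y)=(-1)^{|x||y|}y\otimes x$; $r\in W\otimes W$ is super skew-symmetric if $\sigma(r)=-r$. For a Hom-Jordan superalgebra $(\mathcal{A},\cdot,\gamma)$ and $r=\sum_i x_i\otimes y_i\in\mathcal{A}\otimes\mathcal{A}$ (homogeneous $x_i,y_i$) with $\gamma^{\otimes2}(r)=r$ put $$r_{12}\cdot r_{13}=\sum_{i,j}(-1)^{|x_j||y_i|}x_i\cdot x_j\otimes\gamma(y_i)\otimes\gamma(y_j),\quad r_{12}\cdot r_{23}=\sum_{i,j}\gamma(x_i)\otimes y_i\cdot x_j\otimes\gamma(y_j),$$ $$r_{13}\cdot r_{23}=\sum_{i,j}(-1)^{|x_j||y_i|}\gamma(x_i)\otimes\gamma(x_j)\otimes y_i\cdot y_j.$$ The super Hom-Jordan Yang-Baxter equation (super HJYBE) in $\mathcal{A}$ is $r_{12}\cdot r_{13}-r_{12}\cdot r_{23}+r_{13}\cdot r_{23}=0$. *)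

theory Defs
  imports
    "HOL-Library.Z2"
    "HOL-Library.Function_Algebras"
    "HOL-Library.Product_Plus"
    "HOL-Computational_Algebra.Polynomial"
begin

section \<open>Graded vector spaces\<close>

text \<open>
  Parities are elements of the field \<^typ>\<open>bit\<close> of integers mod 2, so that parities of products
  are sums of parities and exponents of signs can be written as in the literature.
  A graded vector space consists of its homogeneous components, which are subspaces of an ambient
  type; the space itself is their sum, which need not be the whole type (the dual of a space
  over \<^typ>\<open>'v\<close> is a proper subset of the function type from \<^typ>\<open>'v\<close> to the scalars).
  Every space considered carries a twist map.
\<close>

record ('k, 'a) hom_space =
  scl :: "'k \<Rightarrow> 'a \<Rightarrow> 'a"
  grd :: "bit \<Rightarrow> 'a set"
  twist :: "'a \<Rightarrow> 'a"

record ('k, 'a) hom_superalgebra = "('k, 'a) hom_space" +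
  prd :: "'a \<Rightarrow> 'a \<Rightarrow> 'a"

record ('k, 'j, 'v) hom_module = "('k, 'v) hom_space" +
  act :: "'j \<Rightarrow> 'v \<Rightarrow> 'v"

definition ksign :: "bit \<Rightarrow> 'k::ring_1" where
  "ksign a = (if a = 0 then 1 else - 1)"

definition span_grd :: "(bit \<Rightarrow> 'a::ab_group_add set) \<Rightarrow> 'a set" where
  "span_grd G = {x + y | x y. x \<in> G 0 \<and> y \<in> G 1}"

abbreviation carrier :: "('k, 'a::ab_group_add, 'm) hom_space_scheme \<Rightarrow> 'a set" where
  "carrier W \<equiv> span_grd (grd W)"

text \<open>The component of parity \<open>a\<close> of an element of a graded space.\<close>

definition hpart :: "(bit \<Rightarrow> 'a::ab_group_add set) \<Rightarrow> bit \<Rightarrow> 'a \<Rightarrow> 'a" where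
  "hpart G a x = (THE y. y \<in> G a \<and> x - y \<in> G (a + 1))"

text \<open>
  Biadditive extension of a formula \<open>F a b x y\<close> given for homogeneous \<open>x\<close>, \<open>y\<close> of parities
  \<open>a\<close>, \<open>b\<close>.
\<close>

definition hext ::
  "(bit \<Rightarrow> 'a::ab_group_add set) \<Rightarrow> (bit \<Rightarrow> 'b::ab_group_add set) \<Rightarrow>
   (bit \<Rightarrow> bit \<Rightarrow> 'a \<Rightarrow> 'b \<Rightarrow> 'c::comm_monoid_add) \<Rightarrow> 'a \<Rightarrow> 'b \<Rightarrow> 'c" where
  "hext G H F x y = (\<Sum>a\<in>{0, 1}. \<Sum>b\<in>{0, 1}. F a b (hpart G a x) (hpart H b y))"

definition superspace :: "('k::field, 'a::ab_group_add, 'm) hom_space_scheme \<Rightarrow> bool" where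
  "superspace W \<longleftrightarrow>
     vector_space (scl W) \<and> (\<forall>a. module.subspace (scl W) (grd W a)) \<and> grd W 0 \<inter> grd W 1 = {0}"

definition finite_dim :: "('k::field, 'a::ab_group_add, 'm) hom_space_scheme \<Rightarrow> bool" where
  "finite_dim W \<longleftrightarrow> (\<exists>B. finite B \<and> module.span (scl W) B = carrier W)"

definition linear_on ::
  "'a::ab_group_add set \<Rightarrow> ('k \<Rightarrow> 'a \<Rightarrow> 'a) \<Rightarrow> ('k \<Rightarrow> 'b \<Rightarrow> 'b) \<Rightarrow> ('a \<Rightarrow> 'b::ab_group_add) \<Rightarrow> bool" where
  "linear_on S s t f \<longleftrightarrow>
     (\<forall>x\<in>S. \<forall>y\<in>S. f (x + y) = f x + f y) \<and> (\<forall>c. \<forall>x\<in>S. f (s c x) = t c (f x))"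

definition bilinear_on ::
  "('k, 'a::ab_group_add, 'm) hom_space_scheme \<Rightarrow> ('k, 'b::ab_group_add, 'n) hom_space_scheme \<Rightarrow>
   ('k \<Rightarrow> 'c \<Rightarrow> 'c) \<Rightarrow> ('a \<Rightarrow> 'b \<Rightarrow> 'c::ab_group_add) \<Rightarrow> bool" where
  "bilinear_on V W t F \<longleftrightarrow>
     (\<forall>x\<in>carrier V. linear_on (carrier W) (scl W) t (\<lambda>y. F x y)) \<and>
     (\<forall>y\<in>carrier W. linear_on (carrier V) (scl V) t (\<lambda>x. F x y))"

definition trilinear_on ::
  "('k, 'a::ab_group_add, 'm) hom_space_scheme \<Rightarrow>
   ('k \<Rightarrow> 'c \<Rightarrow> 'c) \<Rightarrow> ('a \<Rightarrow> 'a \<Rightarrow> 'a \<Rightarrow> 'c::ab_group_add) \<Rightarrow> bool" where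
  "trilinear_on W t F \<longleftrightarrow>
     (\<forall>y\<in>carrier W. \<forall>z\<in>carrier W. linear_on (carrier W) (scl W) t (\<lambda>x. F x y z)) \<and>
     (\<forall>x\<in>carrier W. \<forall>z\<in>carrier W. linear_on (carrier W) (scl W) t (\<lambda>y. F x y z)) \<and>
     (\<forall>x\<in>carrier W. \<forall>y\<in>carrier W. linear_on (carrier W) (scl W) t (\<lambda>z. F x y z))"

definition even_linear ::
  "('k, 'a::ab_group_add, 'm) hom_space_scheme \<Rightarrow> ('k, 'b::ab_group_add, 'n) hom_space_scheme \<Rightarrow>
   ('a \<Rightarrow> 'b) \<Rightarrow> bool" where
  "even_linear V W f \<longleftrightarrow>
     (\<forall>a. \<forall>x\<in>grd V a. f x \<in> grd W a) \<and> linear_on (carrier V) (scl V) (scl W) f"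


section \<open>Hom-Jordan superalgebras and their modules\<close>

definition hom_associator ::
  "('k, 'a::ab_group_add, 'm) hom_superalgebra_scheme \<Rightarrow> 'a \<Rightarrow> 'a \<Rightarrow> 'a \<Rightarrow> 'a" where
  "hom_associator A x y z = prd A (prd A x y) (twist A z) - prd A (twist A x) (prd A y z)"

definition hom_jordan_superalgebra ::
  "('k::field, 'a::ab_group_add, 'm) hom_superalgebra_scheme \<Rightarrow> bool" where
  "hom_jordan_superalgebra A \<longleftrightarrow>
     superspace A \<and>
     bilinear_on A A (scl A) (prd A) \<and>
     (\<forall>a b. \<forall>x\<in>grd A a. \<forall>y\<in>grd A b. prd A x y \<in> grd A (a + b)) \<and>
     (\<forall>a b. \<forall>x\<in>grd A a. \<forall>y\<in>grd A b. prd A x y = scl A (ksign (a * b)) (prd A y x)) \<and>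
     even_linear A A (twist A) \<and>
     (\<forall>x\<in>carrier A. \<forall>y\<in>carrier A. twist A (prd A x y) = prd A (twist A x) (twist A y)) \<and>
     (\<forall>a b c d. \<forall>x\<in>grd A a. \<forall>y\<in>grd A b. \<forall>z\<in>grd A c. \<forall>u\<in>grd A d.
        scl A (ksign (d * (a + c))) (hom_associator A (prd A x y) (twist A z) (twist A u)) +
        scl A (ksign (a * (b + c))) (hom_associator A (prd A y u) (twist A z) (twist A x)) +
        scl A (ksign (b * (d + c))) (hom_associator A (prd A u x) (twist A z) (twist A y)) = 0)"

definition regular :: "('k, 'a::ab_group_add, 'm) hom_superalgebra_scheme \<Rightarrow> bool" where
  "regular A \<longleftrightarrow> bij_betw (twist A) (carrier A) (carrier A)"

definition hom_jordan_module ::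
  "('k::field, 'j::ab_group_add, 'm) hom_superalgebra_scheme \<Rightarrow>
   ('k, 'j, 'v::ab_group_add, 'n) hom_module_scheme \<Rightarrow> bool" where
  "hom_jordan_module J M \<longleftrightarrow>
     (let \<alpha> = twist J; \<beta> = twist M; \<pi> = act M; m = prd J; s = (\<lambda>a. scl M (ksign a)) in
     superspace M \<and>
     even_linear M M \<beta> \<and>
     bilinear_on J M (scl M) \<pi> \<and>
     (\<forall>a b. \<forall>x\<in>grd J a. \<forall>w\<in>grd M b. \<pi> x w \<in> grd M (a + b)) \<and>
     (\<forall>a. \<forall>x\<in>grd J a. \<forall>w\<in>carrier M. \<beta> (\<pi> x w) = \<pi> (\<alpha> x) (\<beta> w)) \<and>
     (\<forall>a b c. \<forall>x\<in>grd J a. \<forall>y\<in>grd J b. \<forall>z\<in>grd J c. \<forall>w\<in>carrier M.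
        s (a * c) (\<pi> (m (\<alpha> x) (\<alpha> y)) (\<pi> (\<alpha> z) (\<beta> w))) +
        s (a * b) (\<pi> (m (\<alpha> y) (\<alpha> z)) (\<pi> (\<alpha> x) (\<beta> w))) +
        s (b * c) (\<pi> (m (\<alpha> z) (\<alpha> x)) (\<pi> (\<alpha> y) (\<beta> w)))
        =
        s (a * c) (\<pi> (\<alpha> (\<alpha> x)) (\<pi> (m y z) (\<beta> w))) +
        s (a * b) (\<pi> (\<alpha> (\<alpha> y)) (\<pi> (m z x) (\<beta> w))) +
        s (b * c) (\<pi> (\<alpha> (\<alpha> z)) (\<pi> (m x y) (\<beta> w)))
        \<and>
        s (a * c) (\<pi> (m (\<alpha> x) (\<alpha> y)) (\<pi> (\<alpha> z) (\<beta> w))) +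
        s (a * b) (\<pi> (m (\<alpha> y) (\<alpha> z)) (\<pi> (\<alpha> x) (\<beta> w))) +
        s (b * c) (\<pi> (m (\<alpha> z) (\<alpha> x)) (\<pi> (\<alpha> y) (\<beta> w)))
        =
        s (a * c) (\<pi> (\<alpha> (\<alpha> x)) (\<pi> (\<alpha> y) (\<pi> z w))) +
        s (a * b + b * c) (\<pi> (\<alpha> (\<alpha> z)) (\<pi> (\<alpha> y) (\<pi> x w))) +
        s (b * c + a * c) (\<pi> (m (m x z) (\<alpha> y)) (\<beta> (\<beta> w)))))"

text \<open>
  Linear forms on \<open>M\<close> are represented by functions on the ambient type that vanish outside the
  carrier of \<open>M\<close>. A form has parity \<open>a\<close> if it vanishes on the component of the other parity.
\<close>

definition fun_scale :: "'k::field \<Rightarrow> ('b \<Rightarrow> 'k) \<Rightarrow> 'b \<Rightarrow> 'k" where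
  "fun_scale c f = (\<lambda>z. c * f z)"

definition dual_grd :: "('k::field, 'v::ab_group_add, 'm) hom_space_scheme \<Rightarrow> bit \<Rightarrow> ('v \<Rightarrow> 'k) set" where
  "dual_grd M a = {\<xi>. linear_on (carrier M) (scl M) (*) \<xi> \<and> (\<forall>w. w \<notin> carrier M \<longrightarrow> \<xi> w = 0) \<and>
                      (\<forall>w\<in>grd M (a + 1). \<xi> w = 0)}"

definition dual_map ::
  "('k::field, 'v::ab_group_add, 'm) hom_space_scheme \<Rightarrow> ('v \<Rightarrow> 'v) \<Rightarrow> ('v \<Rightarrow> 'k) \<Rightarrow> 'v \<Rightarrow> 'k" where
  "dual_map M f \<xi> = (\<lambda>w. if w \<in> carrier M then \<xi> (f w) else 0)"

definition dual_act ::
  "('k::field, 'j::ab_group_add, 'm) hom_superalgebra_scheme \<Rightarrow>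
   ('k, 'j, 'v::ab_group_add, 'n) hom_module_scheme \<Rightarrow> 'j \<Rightarrow> ('v \<Rightarrow> 'k) \<Rightarrow> 'v \<Rightarrow> 'k" where
  "dual_act J M =
     hext (grd J) (dual_grd M) (\<lambda>a b x \<xi>. fun_scale (ksign (a * b)) (dual_map M (act M x) \<xi>))"

definition dual_module ::
  "('k::field, 'j::ab_group_add, 'm) hom_superalgebra_scheme \<Rightarrow>
   ('k, 'j, 'v::ab_group_add, 'n) hom_module_scheme \<Rightarrow> ('k, 'j, 'v \<Rightarrow> 'k) hom_module" where
  "dual_module J M =
     (let \<beta>' = inv_into (carrier M) (twist M) in
      \<lparr> scl = fun_scale, grd = dual_grd M, twist = dual_map M \<beta>',
        act = (\<lambda>x \<xi>. dual_act J M (twist J x) (dual_map M (\<beta>' \<circ> \<beta>') \<xi>)) \<rparr>)"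

text \<open>The form dual to the element \<open>b\<close> of a basis \<open>B\<close>; it vanishes outside the span of \<open>B\<close>.\<close>

definition dual_vec ::
  "('k::field, 'v::ab_group_add, 'm) hom_space_scheme \<Rightarrow> 'v set \<Rightarrow> 'v \<Rightarrow> 'v \<Rightarrow> 'k" where
  "dual_vec M B b = (\<lambda>w. module.representation (scl M) B w b)"

definition semidirect ::
  "('k::field, 'j::ab_group_add, 'm) hom_superalgebra_scheme \<Rightarrow>
   ('k, 'j, 'v::ab_group_add, 'n) hom_module_scheme \<Rightarrow> ('k, 'j \<times> 'v) hom_superalgebra" where
  "semidirect J M =
     (let G = (\<lambda>a. grd J a \<times> grd M a) in
      \<lparr> scl = (\<lambda>c z. (scl J c (fst z), scl M c (snd z))), grd = G, twist = map_prod (twist J) (twist M),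
        prd = hext G G (\<lambda>a b (x, u) (y, v).
          (prd J x y, act M x v + scl M (ksign (a * b)) (act M y u))) \<rparr>)"

definition O_operator ::
  "('k::field, 'j::ab_group_add, 'm) hom_superalgebra_scheme \<Rightarrow>
   ('k, 'j, 'v::ab_group_add, 'n) hom_module_scheme \<Rightarrow> ('v \<Rightarrow> 'j) \<Rightarrow> bool" where
  "O_operator J M T \<longleftrightarrow>
     even_linear M J T \<and>
     (\<forall>w\<in>carrier M. twist J (T w) = T (twist M w)) \<and>
     (\<forall>a b. \<forall>u\<in>grd M a. \<forall>v\<in>grd M b.
        prd J (T u) (T v) = T (act M (T u) v + scl M (ksign (a * b)) (act M (T v) u)))"


section \<open>Tensor products\<close>

text \<open>
  The tensor square of \<open>W\<close> is realised inside the dual of the space of bilinear forms on \<open>W\<close>: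
  a pure tensor \<open>x \<otimes> y\<close> is the evaluation of forms at \<open>(x, y)\<close>, and the tensor square is the
  linear span of the pure tensors; similarly for the tensor cube. The lemmas
  \<open>tensor2_universal\<close> and \<open>tensor3_universal\<close> below show that these are tensor products.
\<close>

definition tensor2 ::
  "('k::field, 'a::ab_group_add, 'm) hom_space_scheme \<Rightarrow> 'a \<Rightarrow> 'a \<Rightarrow> ('a \<Rightarrow> 'a \<Rightarrow> 'k) \<Rightarrow> 'k" where
  "tensor2 W x y = (\<lambda>B. if bilinear_on W W (*) B then B x y else 0)"

definition tensor3 ::
  "('k::field, 'a::ab_group_add, 'm) hom_space_scheme \<Rightarrow> 'a \<Rightarrow> 'a \<Rightarrow> 'a \<Rightarrow> ('a \<Rightarrow> 'a \<Rightarrow> 'a \<Rightarrow> 'k) \<Rightarrow> 'k" where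
  "tensor3 W x y z = (\<lambda>C. if trilinear_on W (*) C then C x y z else 0)"

definition tensor_square ::
  "('k::field, 'a::ab_group_add, 'm) hom_space_scheme \<Rightarrow> (('a \<Rightarrow> 'a \<Rightarrow> 'k) \<Rightarrow> 'k) set" where
  "tensor_square W = module.span fun_scale {tensor2 W x y | x y. x \<in> carrier W \<and> y \<in> carrier W}"

text \<open>The linear map on the tensor square induced by a bilinear map \<open>F\<close> into the tensor square.\<close>

definition tensor_lift ::
  "('a \<Rightarrow> 'a \<Rightarrow> ('b \<Rightarrow> 'k)) \<Rightarrow> (('a \<Rightarrow> 'a \<Rightarrow> 'k) \<Rightarrow> 'k) \<Rightarrow> 'b \<Rightarrow> 'k" where
  "tensor_lift F r = (\<lambda>B. r (\<lambda>x y. F x y B))"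

definition tensor_swap ::
  "('k::field, 'a::ab_group_add, 'm) hom_space_scheme \<Rightarrow>
   (('a \<Rightarrow> 'a \<Rightarrow> 'k) \<Rightarrow> 'k) \<Rightarrow> ('a \<Rightarrow> 'a \<Rightarrow> 'k) \<Rightarrow> 'k" where
  "tensor_swap W =
     tensor_lift (hext (grd W) (grd W) (\<lambda>a b x y. fun_scale (ksign (a * b)) (tensor2 W y x)))"

definition tensor_twist ::
  "('k::field, 'a::ab_group_add, 'm) hom_space_scheme \<Rightarrow>
   (('a \<Rightarrow> 'a \<Rightarrow> 'k) \<Rightarrow> 'k) \<Rightarrow> ('a \<Rightarrow> 'a \<Rightarrow> 'k) \<Rightarrow> 'k" where
  "tensor_twist W = tensor_lift (\<lambda>x y. tensor2 W (twist W x) (twist W y))"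

definition super_skew_symmetric ::
  "('k::field, 'a::ab_group_add, 'm) hom_space_scheme \<Rightarrow> (('a \<Rightarrow> 'a \<Rightarrow> 'k) \<Rightarrow> 'k) \<Rightarrow> bool" where
  "super_skew_symmetric W r \<longleftrightarrow> r \<in> tensor_square W \<and> tensor_swap W r = - r"


section \<open>The super Hom-Jordan Yang-Baxter equation\<close>

text \<open>
  In the next four definitions, \<open>x\<close>, \<open>y\<close> are the families of left and right factors of a
  presentation of \<open>r\<close> by \<open>n\<close> pure tensors, and \<open>p\<close>, \<open>q\<close> are their parities.
\<close>

definition homogeneous_presentation ::
  "('k::field, 'a::ab_group_add, 'm) hom_space_scheme \<Rightarrow> (('a \<Rightarrow> 'a \<Rightarrow> 'k) \<Rightarrow> 'k) \<Rightarrow>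
   nat \<Rightarrow> (nat \<Rightarrow> 'a) \<Rightarrow> (nat \<Rightarrow> 'a) \<Rightarrow> (nat \<Rightarrow> bit) \<Rightarrow> (nat \<Rightarrow> bit) \<Rightarrow> bool" where
  "homogeneous_presentation W r n x y p q \<longleftrightarrow>
     (\<forall>i<n. x i \<in> grd W (p i) \<and> y i \<in> grd W (q i)) \<and> r = (\<Sum>i<n. tensor2 W (x i) (y i))"

definition r12_r13 ::
  "('k::field, 'a::ab_group_add, 'm) hom_superalgebra_scheme \<Rightarrow>
   nat \<Rightarrow> (nat \<Rightarrow> 'a) \<Rightarrow> (nat \<Rightarrow> 'a) \<Rightarrow> (nat \<Rightarrow> bit) \<Rightarrow> (nat \<Rightarrow> bit) \<Rightarrow> ('a \<Rightarrow> 'a \<Rightarrow> 'a \<Rightarrow> 'k) \<Rightarrow> 'k" where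
  "r12_r13 A n x y p q =
     (\<Sum>i<n. \<Sum>j<n. fun_scale (ksign (p j * q i))
        (tensor3 A (prd A (x i) (x j)) (twist A (y i)) (twist A (y j))))"

definition r12_r23 ::
  "('k::field, 'a::ab_group_add, 'm) hom_superalgebra_scheme \<Rightarrow>
   nat \<Rightarrow> (nat \<Rightarrow> 'a) \<Rightarrow> (nat \<Rightarrow> 'a) \<Rightarrow> ('a \<Rightarrow> 'a \<Rightarrow> 'a \<Rightarrow> 'k) \<Rightarrow> 'k" where
  "r12_r23 A n x y =
     (\<Sum>i<n. \<Sum>j<n. tensor3 A (twist A (x i)) (prd A (y i) (x j)) (twist A (y j)))"

definition r13_r23 ::
  "('k::field, 'a::ab_group_add, 'm) hom_superalgebra_scheme \<Rightarrow>
   nat \<Rightarrow> (nat \<Rightarrow> 'a) \<Rightarrow> (nat \<Rightarrow> 'a) \<Rightarrow> (nat \<Rightarrow> bit) \<Rightarrow> (nat \<Rightarrow> bit) \<Rightarrow> ('a \<Rightarrow> 'a \<Rightarrow> 'a \<Rightarrow> 'k) \<Rightarrow> 'k" where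
  "r13_r23 A n x y p q =
     (\<Sum>i<n. \<Sum>j<n. fun_scale (ksign (p j * q i))
        (tensor3 A (twist A (x i)) (twist A (x j)) (prd A (y i) (y j))))"

text \<open>
  By \<open>presentation_independent\<close> and \<open>homogeneous_presentation_exists\<close> below, the three products
  do not depend on the presentation of \<open>r\<close>, and the quantification over presentations is never
  vacuous. The products are only considered for tensors fixed by the twist, so a solution is
  required to be such a tensor.
\<close>

definition super_HJYBE_solution ::
  "('k::field, 'a::ab_group_add, 'm) hom_superalgebra_scheme \<Rightarrow> (('a \<Rightarrow> 'a \<Rightarrow> 'k) \<Rightarrow> 'k) \<Rightarrow> bool" where
  "super_HJYBE_solution A r \<longleftrightarrow>
     r \<in> tensor_square A \<and> tensor_twist A r = r \<and>
     (\<forall>n x y p q. homogeneous_presentation A r n x y p q \<longrightarrow>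
        r12_r13 A n x y p q - r12_r23 A n x y + r13_r23 A n x y p q = 0)"


section \<open>Adequacy of the definitions\<close>

lemma vector_space_fun_scale: "vector_space fun_scale"
  by unfold_locales (auto simp: fun_scale_def fun_eq_iff algebra_simps)

lemma sum_fun_apply: "(\<Sum>i\<in>I. f i) z = (\<Sum>i\<in>I. f i z)"
  by (induction I rule: infinite_finite_induct) auto

lemma grd_subset_carrier:
  assumes "superspace W" "x \<in> grd W a"
  shows "x \<in> carrier W"
proof -
  interpret vector_space "scl W" using assms by (simp add: superspace_def)
  have z: "0 \<in> grd W b" for b
    using assms subspace_0 by (auto simp: superspace_def)
  show ?thesis
    using assms(2) z by (cases a) (auto simp: span_grd_def, (metis add.left_neutral add.right_neutral)+)
qed

lemma subspace_carrier:
  assumes "superspace W"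
  shows "module.subspace (scl W) (carrier W)"
proof -
  interpret vector_space "scl W" using assms by (simp add: superspace_def)
  have "carrier W = {x + y | x y. x \<in> grd W 0 \<and> y \<in> grd W 1}"
    by (simp add: span_grd_def)
  then show ?thesis
    using subspace_sums[of "grd W 0" "grd W 1"] assms by (auto simp: superspace_def)
qed

lemma hpart_eqI:
  assumes "superspace W" "y \<in> grd W a" "x - y \<in> grd W (a + 1)"
  shows "hpart (grd W) a x = y"
proof -
  interpret vector_space "scl W" using assms by (simp add: superspace_def)
  show ?thesis
    unfolding hpart_def
  proof (rule the_equality)
    fix z assume z: "z \<in> grd W a \<and> x - z \<in> grd W (a + 1)"
    have "z - y \<in> grd W a"
      using z assms subspace_diff by (auto simp: superspace_def)
    moreover have "(x - y) - (x - z) \<in> grd W (a + 1)"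
      using z assms subspace_diff unfolding superspace_def by blast
    then have "z - y \<in> grd W (a + 1)" by simp
    ultimately have "z - y \<in> grd W 0 \<inter> grd W 1" by (cases a) auto
    moreover have "grd W 0 \<inter> grd W 1 = {0}" using assms(1) by (simp add: superspace_def)
    ultimately have "z - y \<in> {0}" by (simp only:)
    then show "z = y" by simp
  qed (use assms in auto)
qed

lemma hpart_carrier:
  assumes "superspace W" "x \<in> carrier W"
  shows "hpart (grd W) a x \<in> grd W a" and "x - hpart (grd W) a x \<in> grd W (a + 1)"
    and "hpart (grd W) 0 x + hpart (grd W) 1 x = x"
proof -
  obtain x0 x1 where *: "x = x0 + x1" "x0 \<in> grd W 0" "x1 \<in> grd W 1"
    using assms(2) by (auto simp: span_grd_def)
  have h: "hpart (grd W) 0 x = x0" "hpart (grd W) 1 x = x1"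
    by (rule hpart_eqI[OF assms(1)]; use * in simp)+
  show "hpart (grd W) a x \<in> grd W a" "x - hpart (grd W) a x \<in> grd W (a + 1)"
    "hpart (grd W) 0 x + hpart (grd W) 1 x = x"
    using h * by (cases a; simp)+
qed

lemma hpart_homogeneous:
  assumes "superspace W" "x \<in> grd W b"
  shows "hpart (grd W) a x = (if a = b then x else 0)"
proof -
  interpret vector_space "scl W" using assms by (simp add: superspace_def)
  have z: "0 \<in> grd W c" for c
    using assms subspace_0 by (auto simp: superspace_def)
  show ?thesis
    by (rule hpart_eqI[OF assms(1)]; use assms z in \<open>cases a; cases b; simp\<close>)
qed

lemma linear_on_hpart:
  assumes "superspace W"
  shows "linear_on (carrier W) (scl W) (scl W) (hpart (grd W) a)"
proof -
  interpret vector_space "scl W" using assms by (simp add: superspace_def)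
  have sub: "subspace (grd W b)" for b using assms by (simp add: superspace_def)
  show ?thesis
    unfolding linear_on_def
  proof (intro conjI ballI allI; rule hpart_eqI[OF assms])
    fix x y assume xy: "x \<in> carrier W" "y \<in> carrier W"
    show "hpart (grd W) a x + hpart (grd W) a y \<in> grd W a"
      using xy hpart_carrier(1)[OF assms] sub subspace_add by blast
    have "(x - hpart (grd W) a x) + (y - hpart (grd W) a y) \<in> grd W (a + 1)"
      using xy hpart_carrier(2)[OF assms] sub subspace_add by blast
    then show "x + y - (hpart (grd W) a x + hpart (grd W) a y) \<in> grd W (a + 1)"
      by (simp add: algebra_simps)
  next
    fix c x assume x: "x \<in> carrier W"
    show "scl W c (hpart (grd W) a x) \<in> grd W a"
      using x hpart_carrier(1)[OF assms] sub subspace_scale by blast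
    have "scl W c (x - hpart (grd W) a x) \<in> grd W (a + 1)"
      using x hpart_carrier(2)[OF assms] sub subspace_scale by blast
    then show "scl W c x - scl W c (hpart (grd W) a x) \<in> grd W (a + 1)"
      by (simp add: scale_right_diff_distrib)
  qed
qed

lemma linear_on_sum:
  assumes "linear_on S s t f" "module.subspace s S" "vector_space s" "vector_space t"
    and "\<And>i. i \<in> I \<Longrightarrow> x i \<in> S"
  shows "f (\<Sum>i\<in>I. s (c i) (x i)) = (\<Sum>i\<in>I. t (c i) (f (x i)))"
proof -
  interpret s: vector_space s by fact
  interpret t: vector_space t by fact
  have f0: "f 0 = 0"
    using assms(1) s.subspace_0[OF assms(2)] by (metis linear_on_def add_cancel_right_left)
  have "f (\<Sum>i\<in>I. s (c i) (x i)) = (\<Sum>i\<in>I. t (c i) (f (x i))) \<and> (\<Sum>i\<in>I. s (c i) (x i)) \<in> S"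
    using assms(5)
  proof (induction I rule: infinite_finite_induct)
    case (insert i I)
    then show ?case
      using assms(1) s.subspace_add[OF assms(2)] s.subspace_scale[OF assms(2)]
      by (auto simp: linear_on_def)
  qed (use f0 s.subspace_0[OF assms(2)] in auto)
  then show ?thesis by blast
qed

text \<open>Two linear maps on the carrier that agree on a basis of it agree.\<close>

lemma linear_on_eq_span:
  assumes "linear_on S s t f" "linear_on S s t g" "module.span s B = S" "vector_space s"
    and "vector_space t" "\<And>b. b \<in> B \<Longrightarrow> f b = g b" "x \<in> S"
  shows "f x = g x"
proof -
  interpret s: vector_space s by fact
  have sub: "s.subspace S" using assms(3) s.subspace_span by blast
  from assms(3,7) obtain F c where F: "finite F" "F \<subseteq> B" "x = (\<Sum>b\<in>F. s (c b) b)"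
    unfolding s.span_explicit by auto
  have FS: "\<And>b. b \<in> F \<Longrightarrow> b \<in> S"
    using F(2) assms(3) s.span_superset by blast
  have "f x = (\<Sum>b\<in>F. t (c b) (f b))" "g x = (\<Sum>b\<in>F. t (c b) (g b))"
    unfolding F(3)
    by (rule linear_on_sum[OF _ sub assms(4,5)]; use assms(1,2) FS in blast)+
  then show ?thesis
    using F(2) assms(6) by (auto intro!: sum.cong)
qed

lemma linear_on_representation:
  assumes "vector_space s" "\<not> module.dependent s B" "module.span s B = S"
  shows "linear_on S s (*) (\<lambda>w. module.representation s B w b)"
proof -
  interpret vector_space s by fact
  show ?thesis
    using assms(2,3) by (auto simp: linear_on_def representation_add representation_scale)
qed

lemma carrier_basis:
  assumes "superspace W"
  obtains B where "B \<subseteq> carrier W" "\<not> module.dependent (scl W) B"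
    "module.span (scl W) B = carrier W"
proof -
  interpret vector_space "scl W" using assms by (simp add: superspace_def)
  obtain B where B: "B \<subseteq> carrier W" "independent B" "carrier W \<subseteq> span B"
    using maximal_independent_subset[of "carrier W"] by blast
  moreover have "span B = carrier W"
    using B span_minimal[OF _ subspace_carrier[OF assms]] by blast
  ultimately show ?thesis using that by blast
qed

lemma independent_if_dual:
  fixes e :: "'b \<Rightarrow> ('c \<Rightarrow> 'k::field)" and d :: "'b \<Rightarrow> 'c"
  assumes "\<And>i j. i \<in> I \<Longrightarrow> j \<in> I \<Longrightarrow> e i (d j) = (if i = j then 1 else 0)"
  shows "\<not> module.dependent fun_scale (e ` I)" and "inj_on e I"
proof -
  interpret vector_space fun_scale by (rule vector_space_fun_scale)
  show inj: "inj_on e I"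
  proof (rule inj_onI)
    fix i j assume ij: "i \<in> I" "j \<in> I" "e i = e j"
    then have "(if i = j then 1 else 0) = (1::'k)"
      using assms[of i j] assms[of j j] by simp
    then show "i = j" by (simp split: if_splits)
  qed
  show "\<not> dependent (e ` I)"
  proof
    assume "dependent (e ` I)"
    then obtain F c f where F: "finite F" "F \<subseteq> e ` I" "f \<in> F" "c f \<noteq> 0"
        "(\<Sum>f\<in>F. fun_scale (c f) f) = 0"
      unfolding dependent_explicit by blast
    obtain j where j: "j \<in> I" "f = e j" using F by blast
    have "0 = (\<Sum>g\<in>F. fun_scale (c g) g) (d j)" using F(5) by simp
    also have "\<dots> = (\<Sum>g\<in>F. c g * g (d j))"
      by (simp add: sum_fun_apply fun_scale_def)
    also have "\<dots> = (\<Sum>g\<in>F. if g = f then c g else 0)"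
    proof (rule sum.cong[OF refl])
      fix g assume "g \<in> F"
      then obtain i where i: "i \<in> I" "g = e i" using F by blast
      then show "c g * g (d j) = (if g = f then c g else 0)"
        using assms[OF i(1) j(1)] j i inj_onD[OF inj, of i j] by auto
    qed
    also have "\<dots> = c f" using F by simp
    finally show False using F by simp
  qed
qed

lemma bilinear_on_tensor2: "bilinear_on W W fun_scale (tensor2 W)"
  by (auto simp: bilinear_on_def linear_on_def tensor2_def fun_scale_def fun_eq_iff)

lemma trilinear_on_tensor3: "trilinear_on W fun_scale (tensor3 W)"
  by (auto simp: trilinear_on_def linear_on_def tensor3_def fun_scale_def fun_eq_iff)

lemma bilinear_on_hext_form:
  assumes "\<And>a b. bilinear_on V W (*) (\<lambda>x y. F a b x y)"
  shows "bilinear_on V W (*) (\<lambda>x y. \<Sum>a\<in>{0::bit, 1}. \<Sum>b\<in>{0::bit, 1}. (c a b :: 'k::field) * F a b x y)"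
  using assms
  unfolding bilinear_on_def linear_on_def
  by (simp add: distrib_left sum.distrib sum_distrib_left mult.left_commute)

theorem tensor2_universal:
  fixes W :: "('k::field, 'a::ab_group_add, 'm) hom_space_scheme"
    and t :: "'k \<Rightarrow> 'z::ab_group_add \<Rightarrow> 'z"
  assumes W: "superspace W" and t: "vector_space t" and F: "bilinear_on W W t F"
  shows "\<exists>L. Vector_Spaces.linear fun_scale t L \<and>
             (\<forall>x\<in>carrier W. \<forall>y\<in>carrier W. L (tensor2 W x y) = F x y)"
proof -
  interpret w: vector_space "scl W" using W by (simp add: superspace_def)
  interpret p: vector_space_pair fun_scale t
    using t vector_space_fun_scale by (simp add: vector_space_pair_def)
  obtain B where B: "B \<subseteq> carrier W" "w.independent B" "w.span B = carrier W"
    using carrier_basis[OF W] by blast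
  define rp where "rp = w.representation B"
  define e where "e = (\<lambda>(b, b'). tensor2 W b b')"
  define d where "d = (\<lambda>(b, b') x y. rp x b * rp y b')"
  have lin: "linear_on (carrier W) (scl W) (*) (\<lambda>x. rp x b)" for b
    unfolding rp_def by (rule linear_on_representation[OF w.vector_space_axioms B(2,3)])
  have bil: "bilinear_on W W (*) (d i)" for i
    using lin by (auto simp: bilinear_on_def d_def linear_on_def algebra_simps split: prod.splits)
  have rb: "rp b b' = (if b = b' then 1 else 0)" if "b \<in> B" for b b'
    unfolding rp_def using w.representation_basis[OF B(2) that] by auto
  have ed: "e i (d j) = (if i = j then 1 else 0)" if "i \<in> B \<times> B" "j \<in> B \<times> B" for i j
    using that bil[of j] by (auto simp: e_def tensor2_def d_def rb split: prod.splits)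
  have ind: "\<not> module.dependent fun_scale (e ` (B \<times> B))" and inj: "inj_on e (B \<times> B)"
    using independent_if_dual[of "B \<times> B" e d] ed by blast+
  obtain L where L: "Vector_Spaces.linear fun_scale t L"
      "\<forall>r\<in>e ` (B \<times> B). L r = (case inv_into (B \<times> B) e r of (b, b') \<Rightarrow> F b b')"
    using p.linear_independent_extend[OF ind,
        of "\<lambda>r. case inv_into (B \<times> B) e r of (b, b') \<Rightarrow> F b b'"] by blast
  interpret L: Vector_Spaces.linear fun_scale t L by (rule L(1))
  have LF: "L (tensor2 W b b') = F b b'" if "b \<in> B" "b' \<in> B" for b b'
  proof -
    have "L (e (b, b')) = F b b'"
      using L(2) that inv_into_f_f[OF inj, of "(b, b')"] by force
    then show ?thesis by (simp add: e_def)
  qed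
  have Lt: "bilinear_on W W t (\<lambda>x y. L (tensor2 W x y))"
    using bilinear_on_tensor2[of W] by (auto simp: bilinear_on_def linear_on_def L.add L.scale)
  have BW: "b \<in> carrier W" if "b \<in> B" for b using B that by blast
  note eq = linear_on_eq_span[OF _ _ B(3) w.vector_space_axioms t]
  have 1: "L (tensor2 W x b) = F x b" if "x \<in> carrier W" "b \<in> B" for x b
    by (rule eq[where f = "\<lambda>x. L (tensor2 W x b)" and g = "\<lambda>x. F x b"])
      (use Lt F LF BW that in \<open>auto simp: bilinear_on_def\<close>)
  have "L (tensor2 W x y) = F x y" if "x \<in> carrier W" "y \<in> carrier W" for x y
    by (rule eq[where f = "\<lambda>y. L (tensor2 W x y)" and g = "\<lambda>y. F x y"])
      (use Lt F 1 BW that in \<open>auto simp: bilinear_on_def\<close>)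
  then show ?thesis using L(1) by blast
qed

theorem tensor3_universal:
  fixes W :: "('k::field, 'a::ab_group_add, 'm) hom_space_scheme"
    and t :: "'k \<Rightarrow> 'z::ab_group_add \<Rightarrow> 'z"
  assumes W: "superspace W" and t: "vector_space t" and F: "trilinear_on W t F"
  shows "\<exists>L. Vector_Spaces.linear fun_scale t L \<and>
             (\<forall>x\<in>carrier W. \<forall>y\<in>carrier W. \<forall>z\<in>carrier W. L (tensor3 W x y z) = F x y z)"
proof -
  interpret w: vector_space "scl W" using W by (simp add: superspace_def)
  interpret p: vector_space_pair fun_scale t
    using t vector_space_fun_scale by (simp add: vector_space_pair_def)
  obtain B where B: "B \<subseteq> carrier W" "w.independent B" "w.span B = carrier W"
    using carrier_basis[OF W] by blast
  define rp where "rp = w.representation B"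
  define e where "e = (\<lambda>(b, b', b''). tensor3 W b b' b'')"
  define d where "d = (\<lambda>(b, b', b'') x y z. rp x b * rp y b' * rp z b'')"
  have lin: "linear_on (carrier W) (scl W) (*) (\<lambda>x. rp x b)" for b
    unfolding rp_def by (rule linear_on_representation[OF w.vector_space_axioms B(2,3)])
  have tri: "trilinear_on W (*) (d i)" for i
    using lin by (auto simp: trilinear_on_def d_def linear_on_def algebra_simps split: prod.splits)
  have rb: "rp b b' = (if b = b' then 1 else 0)" if "b \<in> B" for b b'
    unfolding rp_def using w.representation_basis[OF B(2) that] by auto
  have ed: "e i (d j) = (if i = j then 1 else 0)"
    if "i \<in> B \<times> B \<times> B" "j \<in> B \<times> B \<times> B" for i j
    using that tri[of j] by (auto simp: e_def tensor3_def d_def rb split: prod.splits)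
  have ind: "\<not> module.dependent fun_scale (e ` (B \<times> B \<times> B))" and inj: "inj_on e (B \<times> B \<times> B)"
    using independent_if_dual[of "B \<times> B \<times> B" e d] ed by blast+
  obtain L where L: "Vector_Spaces.linear fun_scale t L"
      "\<forall>r\<in>e ` (B \<times> B \<times> B). L r = (case inv_into (B \<times> B \<times> B) e r of (b, b', b'') \<Rightarrow> F b b' b'')"
    using p.linear_independent_extend[OF ind,
        of "\<lambda>r. case inv_into (B \<times> B \<times> B) e r of (b, b', b'') \<Rightarrow> F b b' b''"] by blast
  interpret L: Vector_Spaces.linear fun_scale t L by (rule L(1))
  have LF: "L (tensor3 W b b' b'') = F b b' b''" if "b \<in> B" "b' \<in> B" "b'' \<in> B" for b b' b''
  proof -
    have "L (e (b, b', b'')) = F b b' b''"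
      using L(2) that inv_into_f_f[OF inj, of "(b, b', b'')"] by force
    then show ?thesis by (simp add: e_def)
  qed
  have Lt: "trilinear_on W t (\<lambda>x y z. L (tensor3 W x y z))"
    using trilinear_on_tensor3[of W] by (auto simp: trilinear_on_def linear_on_def L.add L.scale)
  have BW: "b \<in> carrier W" if "b \<in> B" for b using B that by blast
  note eq = linear_on_eq_span[OF _ _ B(3) w.vector_space_axioms t]
  have 1: "L (tensor3 W x b c) = F x b c" if "x \<in> carrier W" "b \<in> B" "c \<in> B" for x b c
    by (rule eq[where f = "\<lambda>x. L (tensor3 W x b c)" and g = "\<lambda>x. F x b c"])
      (use Lt F LF BW that in \<open>auto simp: trilinear_on_def\<close>)
  have 2: "L (tensor3 W x y c) = F x y c" if "x \<in> carrier W" "y \<in> carrier W" "c \<in> B" for x y c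
    by (rule eq[where f = "\<lambda>y. L (tensor3 W x y c)" and g = "\<lambda>y. F x y c"])
      (use Lt F 1 BW that in \<open>auto simp: trilinear_on_def\<close>)
  have "L (tensor3 W x y z) = F x y z"
    if "x \<in> carrier W" "y \<in> carrier W" "z \<in> carrier W" for x y z
    by (rule eq[where f = "\<lambda>z. L (tensor3 W x y z)" and g = "\<lambda>z. F x y z"])
      (use Lt F 2 BW that in \<open>auto simp: trilinear_on_def\<close>)
  then show ?thesis using L(1) by blast
qed

text \<open>The defining properties of the induced maps on the tensor square.\<close>

lemma tensor_lift_linear:
  "tensor_lift F (r + r') = tensor_lift F r + tensor_lift F r'"
  "tensor_lift F (fun_scale c r) = fun_scale c (tensor_lift F r)"
  by (auto simp: tensor_lift_def fun_scale_def)

lemma tensor_twist_tensor2: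
  assumes "superspace W" "even_linear W W (twist W)" "x \<in> carrier W" "y \<in> carrier W"
  shows "tensor_twist W (tensor2 W x y) = tensor2 W (twist W x) (twist W y)"
proof
  fix B
  have tw: "twist W x \<in> carrier W" if x: "x \<in> carrier W" for x
  proof -
    obtain x0 x1 where *: "x = x0 + x1" "x0 \<in> grd W 0" "x1 \<in> grd W 1"
      using x by (auto simp: span_grd_def)
    then have "twist W x = twist W x0 + twist W x1"
      using assms(2) grd_subset_carrier[OF assms(1)] by (simp add: even_linear_def linear_on_def)
    then show ?thesis using * assms(2) by (auto simp: even_linear_def span_grd_def)
  qed
  have "bilinear_on W W (*) (\<lambda>x y. tensor2 W (twist W x) (twist W y) B)"
  proof (cases "bilinear_on W W (*) B")
    case True
    moreover have "twist W (x + y) = twist W x + twist W y" "twist W (scl W c x) = scl W c (twist W x)"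
      if "x \<in> carrier W" "y \<in> carrier W" for x y c
      using assms(2) that by (simp_all add: even_linear_def linear_on_def)
    ultimately show ?thesis
      by (simp add: tensor2_def) (simp add: bilinear_on_def linear_on_def tw)
  next
    case False
    then have "tensor2 W (twist W x) (twist W y) B = 0" for x y
      by (simp add: tensor2_def)
    then show ?thesis by (simp add: bilinear_on_def linear_on_def)
  qed
  then show "tensor_twist W (tensor2 W x y) B = tensor2 W (twist W x) (twist W y) B"
    by (simp add: tensor_twist_def tensor_lift_def tensor2_def[of W x y])
qed

lemma tensor_swap_tensor2:
  assumes W: "superspace W" and x: "x \<in> grd W a" and y: "y \<in> grd W b"
  shows "tensor_swap W (tensor2 W x y) = fun_scale (ksign (a * b)) (tensor2 W y x)"
proof
  fix B
  interpret w: vector_space "scl W" using W by (simp add: superspace_def)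
  define H where "H = hext (grd W) (grd W) (\<lambda>a b x y. fun_scale (ksign (a * b)) (tensor2 W y x))"
  have hp: "hpart (grd W) a x \<in> carrier W" if "x \<in> carrier W" for a x
    using hpart_carrier(1)[OF W that] grd_subset_carrier[OF W] by blast
  have lin: "hpart (grd W) a (x + y) = hpart (grd W) a x + hpart (grd W) a y"
    "hpart (grd W) a (scl W c x) = scl W c (hpart (grd W) a x)"
    if "x \<in> carrier W" "y \<in> carrier W" for a c x y
    using linear_on_hpart[OF W] that unfolding linear_on_def by blast+
  have lins: "hpart (grd W) a (scl W c x) = scl W c (hpart (grd W) a x)" if "x \<in> carrier W" for a c x
    using lin that by blast
  have bil: "bilinear_on W W (*) (\<lambda>x y. H x y B)"
  proof -
    have "bilinear_on W W (*) (\<lambda>x y. tensor2 W (hpart (grd W) b y) (hpart (grd W) a x) B)" for a b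
    proof (cases "bilinear_on W W (*) B")
      case True
      then have "B (x + x') y = B x y + B x' y" "B x (y + y') = B x y + B x y'"
        "B (scl W c x) y = c * B x y" "B x (scl W c y) = c * B x y"
        if "x \<in> carrier W" "x' \<in> carrier W" "y \<in> carrier W" "y' \<in> carrier W" for x x' y y' c
        using that by (simp_all add: bilinear_on_def linear_on_def)
      then show ?thesis
        using True by (simp add: tensor2_def) (simp add: bilinear_on_def linear_on_def lin lins hp)
    next
      case False
      then have "tensor2 W (hpart (grd W) b y) (hpart (grd W) a x) B = 0" for x y
        by (simp add: tensor2_def)
      then show ?thesis by (simp add: bilinear_on_def linear_on_def)
    qed
    from bilinear_on_hext_form[OF this, of "\<lambda>a b. ksign (a * b)"]
    show ?thesis by (simp add: H_def hext_def sum_fun_apply fun_scale_def)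
  qed
  have z: "tensor2 W y 0 = 0" "tensor2 W 0 x = 0" "tensor2 W 0 0 = 0"
  proof -
    have "0 \<in> carrier W" using w.subspace_0[OF subspace_carrier[OF W]] .
    moreover have "F 0 v = 0" "F v 0 = 0" if "bilinear_on W W (*) F" "v \<in> carrier W" "0 \<in> carrier W"
      for F :: "'b \<Rightarrow> 'b \<Rightarrow> 'a" and v
      using that by (auto simp: bilinear_on_def linear_on_def) (metis add_cancel_right_left)+
    ultimately show "tensor2 W y 0 = 0" "tensor2 W 0 x = 0" "tensor2 W 0 0 = 0"
      using grd_subset_carrier[OF W x] grd_subset_carrier[OF W y]
      by (auto simp: tensor2_def fun_eq_iff)
  qed
  have "H x y = fun_scale (ksign (a * b)) (tensor2 W y x)"
    by (cases a; cases b)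
      (simp_all add: H_def hext_def hpart_homogeneous[OF W x] hpart_homogeneous[OF W y] z
        fun_scale_def fun_eq_iff)
  then show "tensor_swap W (tensor2 W x y) B = fun_scale (ksign (a * b)) (tensor2 W y x) B"
    using bil unfolding tensor_swap_def H_def[symmetric] tensor_lift_def tensor2_def[of W x y]
    by simp
qed

lemma homogeneous_presentation_exists:
  assumes W: "superspace W" and r: "r \<in> tensor_square W"
  shows "\<exists>n x y p q. homogeneous_presentation W r n x y p q"
proof -
  interpret f: vector_space fun_scale by (rule vector_space_fun_scale)
  interpret w: vector_space "scl W" using W by (simp add: superspace_def)
  define P where "P r \<longleftrightarrow> (\<exists>n x y p q. homogeneous_presentation W r n x y p q)" for r
  have P1: "P (tensor2 W x y)" if "x \<in> grd W a" "y \<in> grd W b" for x y a b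
    unfolding P_def homogeneous_presentation_def
    by (rule exI[of _ 1], rule exI[of _ "\<lambda>_. x"], rule exI[of _ "\<lambda>_. y"],
        rule exI[of _ "\<lambda>_. a"], rule exI[of _ "\<lambda>_. b"]) (use that in simp)
  have Pa: "P (r + r')" if rr: "P r" "P r'" for r r'
  proof -
    obtain n x y p q where 1: "homogeneous_presentation W r n x y p q" using rr P_def by blast
    obtain n' x' y' p' q' where 2: "homogeneous_presentation W r' n' x' y' p' q'" using rr P_def by blast
    define X where "X i = (if i < n then x i else x' (i - n))" for i
    define Y where "Y i = (if i < n then y i else y' (i - n))" for i
    have "(\<Sum>i<n + n'. tensor2 W (X i) (Y i)) = r + r'"
      using 1 2 sum.atLeastLessThan_concat[of 0 n "n + n'" "\<lambda>i. tensor2 W (X i) (Y i)"]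
        sum.shift_bounds_nat_ivl[of "\<lambda>i. tensor2 W (X i) (Y i)" 0 n n']
      by (simp add: homogeneous_presentation_def X_def Y_def atLeast0LessThan add.commute)
    then have "homogeneous_presentation W (r + r') (n + n') X Y
        (\<lambda>i. if i < n then p i else p' (i - n)) (\<lambda>i. if i < n then q i else q' (i - n))"
      using 1 2 by (auto simp: homogeneous_presentation_def X_def Y_def)
    then show ?thesis unfolding P_def by blast
  qed
  have P2: "P (tensor2 W x y)" if xy: "x \<in> carrier W" "y \<in> carrier W" for x y
  proof -
    obtain x0 x1 where x: "x = x0 + x1" "x0 \<in> grd W 0" "x1 \<in> grd W 1"
      using xy by (auto simp: span_grd_def)
    obtain y0 y1 where y: "y = y0 + y1" "y0 \<in> grd W 0" "y1 \<in> grd W 1"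
      using xy by (auto simp: span_grd_def)
    have c: "x0 \<in> carrier W" "x1 \<in> carrier W" "y0 \<in> carrier W" "y1 \<in> carrier W"
      using x y grd_subset_carrier[OF W] by blast+
    have "tensor2 W x y = (tensor2 W x0 y0 + tensor2 W x0 y1) + (tensor2 W x1 y0 + tensor2 W x1 y1)"
      using bilinear_on_tensor2[of W] c xy
      by (simp add: bilinear_on_def linear_on_def x(1) y(1) algebra_simps)
    then show ?thesis using P1 Pa x y by metis
  qed
  have "P r"
    using r unfolding tensor_square_def
  proof (induction rule: f.span_induct_alt)
    case base
    show ?case
      unfolding P_def homogeneous_presentation_def by (rule exI[of _ 0]) simp
  next
    case (step c t r)
    then obtain x y where xy: "t = tensor2 W x y" "x \<in> carrier W" "y \<in> carrier W" by blast
    have "fun_scale c t = tensor2 W (scl W c x) y"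
      using bilinear_on_tensor2[of W] xy by (simp add: bilinear_on_def linear_on_def)
    moreover have "scl W c x \<in> carrier W"
      using w.subspace_scale[OF subspace_carrier[OF W]] xy by blast
    ultimately show ?case using P2 Pa step xy by metis
  qed
  then show ?thesis unfolding P_def .
qed

lemma double_sum_presentation:
  fixes W :: "('k::field, 'a::ab_group_add, 'm) hom_space_scheme"
  assumes W: "superspace W" and r: "homogeneous_presentation W r n x y p q"
    and K: "\<And>v w. v \<in> carrier W \<Longrightarrow> w \<in> carrier W \<Longrightarrow> bilinear_on W W (*) (K v w)"
      "\<And>v w. v \<in> carrier W \<Longrightarrow> w \<in> carrier W \<Longrightarrow> bilinear_on W W (*) (\<lambda>v' w'. K v' w' v w)"
  shows "(\<Sum>i<n. \<Sum>j<n. K (x i) (y i) (x j) (y j)) = r (\<lambda>v w. r (K v w))"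
proof -
  interpret w: vector_space "scl W" using W by (simp add: superspace_def)
  have xy: "x i \<in> carrier W" "y i \<in> carrier W" if "i < n" for i
    using r that grd_subset_carrier[OF W] by (auto simp: homogeneous_presentation_def)
  have rB: "r B = (\<Sum>i<n. B (x i) (y i))" if "bilinear_on W W (*) B" for B
    using r that by (simp add: homogeneous_presentation_def sum_fun_apply tensor2_def)
  have sub: "v + w \<in> carrier W" "scl W c v \<in> carrier W"
    if "v \<in> carrier W" "w \<in> carrier W" for v w c
    using that w.subspace_add w.subspace_scale subspace_carrier[OF W] by blast+
  have rK: "r (K v w) = (\<Sum>j<n. K v w (x j) (y j))"
    if "v \<in> carrier W" "w \<in> carrier W" for v w
    using rB K that by blast
  have K2: "bilinear_on W W (*) (\<lambda>v w. K v w (x j) (y j))" if "j < n" for j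
    using K(2) xy that by blast
  have "bilinear_on W W (*) (\<lambda>v w. r (K v w))"
    unfolding bilinear_on_def linear_on_def
    using K2
    by (auto simp: rK sub sum.distrib[symmetric] sum_distrib_left bilinear_on_def linear_on_def
        intro!: sum.cong)
  then show ?thesis
    using rB rK xy by simp
qed

theorem presentation_independent:
  fixes A :: "('k::field, 'a::ab_group_add, 'm) hom_superalgebra_scheme"
  assumes W: "superspace A" and B: "bilinear_on A A (scl A) (prd A)"
    and E: "\<And>a b x y. x \<in> grd A a \<Longrightarrow> y \<in> grd A b \<Longrightarrow> prd A x y \<in> grd A (a + b)"
    and T: "even_linear A A (twist A)"
    and r: "homogeneous_presentation A r n x y p q" "homogeneous_presentation A r n' x' y' p' q'"
  shows "r12_r13 A n x y p q = r12_r13 A n' x' y' p' q'"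
    and "r12_r23 A n x y = r12_r23 A n' x' y'"
    and "r13_r23 A n x y p q = r13_r23 A n' x' y' p' q'"
proof -
  interpret w: vector_space "scl A" using W by (simp add: superspace_def)
  note gc = grd_subset_carrier[OF W]
  have sub: "v + w \<in> carrier A" "scl A c v \<in> carrier A"
    if "v \<in> carrier A" "w \<in> carrier A" for v w c
    using that w.subspace_add w.subspace_scale subspace_carrier[OF W] by blast+
  have sc: "scl A c v \<in> carrier A" if "v \<in> carrier A" for v c
    using sub that by blast
  have z: "0 \<in> carrier A" using w.subspace_0[OF subspace_carrier[OF W]] .
  define h where "h = hpart (grd A)"
  have h: "h a v \<in> carrier A" "h a (v + w) = h a v + h a w" "h a (scl A c v) = scl A c (h a v)"
    if "v \<in> carrier A" "w \<in> carrier A" for a v w c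
    using that hpart_carrier(1)[OF W] gc linear_on_hpart[OF W] unfolding h_def linear_on_def by blast+
  have hc: "h a v \<in> carrier A" "h a (scl A c v) = scl A c (h a v)"
    if "v \<in> carrier A" for a v c
    using h that by blast+
  have pr: "prd A (v + v') w = prd A v w + prd A v' w" "prd A v (w + w') = prd A v w + prd A v w'"
    "prd A (scl A c v) w = scl A c (prd A v w)" "prd A v (scl A c w) = scl A c (prd A v w)"
    if "v \<in> carrier A" "v' \<in> carrier A" "w \<in> carrier A" "w' \<in> carrier A" for v v' w w' c
    using B that by (auto simp: bilinear_on_def linear_on_def)
  have prs: "prd A (scl A c v) w = scl A c (prd A v w)" "prd A v (scl A c w) = scl A c (prd A v w)"
    if "v \<in> carrier A" "w \<in> carrier A" for v w c
    using pr that by blast+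
  have prc: "prd A v w \<in> carrier A" if vw: "v \<in> carrier A" "w \<in> carrier A" for v w
  proof -
    obtain v0 v1 where v: "v = v0 + v1" "v0 \<in> grd A 0" "v1 \<in> grd A 1"
      using vw by (auto simp: span_grd_def)
    obtain w0 w1 where w: "w = w0 + w1" "w0 \<in> grd A 0" "w1 \<in> grd A 1"
      using vw by (auto simp: span_grd_def)
    have "prd A v w = (prd A v0 w0 + prd A v0 w1) + (prd A v1 w0 + prd A v1 w1)"
      using v w gc vw by (simp add: pr)
    moreover have "prd A s t \<in> carrier A" if "s \<in> {v0, v1}" "t \<in> {w0, w1}" for s t
      using that E gc v w by blast
    ultimately show ?thesis using sub(1) by simp
  qed
  have twc: "twist A v \<in> carrier A" if vw: "v \<in> carrier A" for v
  proof -
    obtain v0 v1 where v: "v = v0 + v1" "v0 \<in> grd A 0" "v1 \<in> grd A 1"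
      using vw by (auto simp: span_grd_def)
    then have "twist A v = twist A v0 + twist A v1"
      using T gc by (simp add: even_linear_def linear_on_def)
    then show ?thesis using v T by (auto simp: even_linear_def span_grd_def)
  qed
  have tw: "twist A (v + w) = twist A v + twist A w"
    if "v \<in> carrier A" "w \<in> carrier A" for v w
    using T that by (auto simp: even_linear_def linear_on_def)
  have tws: "twist A (scl A c v) = scl A c (twist A v)"
    if "v \<in> carrier A" for v c
    using T that by (auto simp: even_linear_def linear_on_def)
  have hh: "h a v = (if a = b then v else 0)" if "v \<in> grd A b" for a b v
    unfolding h_def by (rule hpart_homogeneous[OF W that])
  have pz: "prd A v 0 = 0" "prd A 0 v = 0" if "v \<in> carrier A" for v
    using pr(1)[of 0 0 v v] pr(2)[of v v 0 0] z that by simp_all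
  have tz: "twist A 0 = 0" using tw[OF z z] by simp

  define k1 where "k1 C a b v w v' w' = C (prd A v (h a v')) (twist A (h b w)) (twist A w')"
    for C :: "'a \<Rightarrow> 'a \<Rightarrow> 'a \<Rightarrow> 'k" and a b v w v' w'
  define k3 where "k3 C a b v w v' w' = C (twist A v) (twist A (h a v')) (prd A (h b w) w')"
    for C :: "'a \<Rightarrow> 'a \<Rightarrow> 'a \<Rightarrow> 'k" and a b v w v' w'
  define K1 where "K1 = (\<lambda>(C :: 'a \<Rightarrow> 'a \<Rightarrow> 'a \<Rightarrow> 'k) v w v' w'.
      (\<Sum>a\<in>{0, 1}. \<Sum>b\<in>{0, 1}. ksign (a * b) * k1 C a b v w v' w'))"
  define K2 where "K2 C v w v' w' = C (twist A v) (prd A w v') (twist A w')"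
    for C :: "'a \<Rightarrow> 'a \<Rightarrow> 'a \<Rightarrow> 'k" and v w v' w'
  define K3 where "K3 = (\<lambda>(C :: 'a \<Rightarrow> 'a \<Rightarrow> 'a \<Rightarrow> 'k) v w v' w'.
      (\<Sum>a\<in>{0, 1}. \<Sum>b\<in>{0, 1}. ksign (a * b) * k3 C a b v w v' w'))"

  have key: "r12_r13 A n x y p q C = (if trilinear_on A (*) C then r (\<lambda>v w. r (K1 C v w)) else 0)
      \<and> r12_r23 A n x y C = (if trilinear_on A (*) C then r (\<lambda>v w. r (K2 C v w)) else 0)
      \<and> r13_r23 A n x y p q C = (if trilinear_on A (*) C then r (\<lambda>v w. r (K3 C v w)) else 0)"
    if r: "homogeneous_presentation A r n x y p q" for C n x y p q
  proof (cases "trilinear_on A (*) C")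
    case False
    then show ?thesis
      by (simp add: r12_r13_def r12_r23_def r13_r23_def sum_fun_apply tensor3_def fun_scale_def)
  next
    case True
    have C: "C (a + a') b c = C a b c + C a' b c" "C a (b + b') c = C a b c + C a b' c"
      "C a b (c + c') = C a b c + C a b c'"
      if "a \<in> carrier A" "a' \<in> carrier A" "b \<in> carrier A" "b' \<in> carrier A" "c \<in> carrier A" "c' \<in> carrier A"
      for a a' b b' c c'
      using True that by (auto simp: trilinear_on_def linear_on_def)
    have Cs: "C (scl A k a) b c = k * C a b c" "C a (scl A k b) c = k * C a b c"
      "C a b (scl A k c) = k * C a b c"
      if "a \<in> carrier A" "b \<in> carrier A" "c \<in> carrier A" for a b c k
      using True that by (auto simp: trilinear_on_def linear_on_def)
    have Cz: "C 0 b c = 0" "C b 0 c = 0" "C b c 0 = 0" if "b \<in> carrier A" "c \<in> carrier A" for b c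
      using Cs(1)[of 0 b c 0] Cs(2)[of b 0 c 0] Cs(3)[of b c 0 0] z that by simp_all
    have g: "x i \<in> grd A (p i)" "y i \<in> grd A (q i)" if "i < n" for i
      using r that by (auto simp: homogeneous_presentation_def)
    have gC: "x i \<in> carrier A" "y i \<in> carrier A" if "i < n" for i
      using g that gc by blast+
    have bk: "bilinear_on A A (*) (k1 C a b v w)" "bilinear_on A A (*) (\<lambda>v' w'. k1 C a b v' w' v w)"
        "bilinear_on A A (*) (k3 C a b v w)" "bilinear_on A A (*) (\<lambda>v' w'. k3 C a b v' w' v w)"
        "bilinear_on A A (*) (K2 C v w)" "bilinear_on A A (*) (\<lambda>v' w'. K2 C v' w' v w)"
      if "v \<in> carrier A" "w \<in> carrier A" for v w a b
      unfolding bilinear_on_def linear_on_def k1_def k3_def K2_def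
      by (simp_all add: that h hc pr prs prc twc tw tws C Cs)
    have bK: "bilinear_on A A (*) (K C v w)" "bilinear_on A A (*) (\<lambda>v' w'. K C v' w' v w)"
      if "v \<in> carrier A" "w \<in> carrier A" "K \<in> {K1, K2, K3}" for v w K
      using that(3) bk[OF that(1,2)] bilinear_on_hext_form[OF bk(1)[OF that(1,2)]]
        bilinear_on_hext_form[OF bk(2)[OF that(1,2)]] bilinear_on_hext_form[OF bk(3)[OF that(1,2)]]
        bilinear_on_hext_form[OF bk(4)[OF that(1,2)]]
      by (auto simp only: K1_def K3_def insert_iff empty_iff)
    have e1: "K1 C (x i) (y i) (x j) (y j) =
        ksign (p j * q i) * C (prd A (x i) (x j)) (twist A (y i)) (twist A (y j))" if "i < n" "j < n" for i j
      using that gC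
      by (cases "p j"; cases "q i")
        (simp_all add: K1_def k1_def hh[OF g(1)] hh[OF g(2)] Cz pz tz z twc prc)
    have e3: "K3 C (x i) (y i) (x j) (y j) =
        ksign (p j * q i) * C (twist A (x i)) (twist A (x j)) (prd A (y i) (y j))" if "i < n" "j < n" for i j
      using that gC
      by (cases "p j"; cases "q i")
        (simp_all add: K3_def k3_def hh[OF g(1)] hh[OF g(2)] Cz pz tz z twc prc)
    have "r12_r13 A n x y p q C = (\<Sum>i<n. \<Sum>j<n. K1 C (x i) (y i) (x j) (y j))"
      using True by (simp add: r12_r13_def sum_fun_apply fun_scale_def tensor3_def e1)
    moreover have "r12_r23 A n x y C = (\<Sum>i<n. \<Sum>j<n. K2 C (x i) (y i) (x j) (y j))"
      using True by (simp add: r12_r23_def sum_fun_apply tensor3_def K2_def)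
    moreover have "r13_r23 A n x y p q C = (\<Sum>i<n. \<Sum>j<n. K3 C (x i) (y i) (x j) (y j))"
      using True by (simp add: r13_r23_def sum_fun_apply fun_scale_def tensor3_def e3)
    moreover note double_sum_presentation[OF W r bK[of _ _ K1]]
      double_sum_presentation[OF W r bK[of _ _ K2]] double_sum_presentation[OF W r bK[of _ _ K3]]
    ultimately show ?thesis using True by simp
  qed
  show "r12_r13 A n x y p q = r12_r13 A n' x' y' p' q'" "r12_r23 A n x y = r12_r23 A n' x' y'"
    "r13_r23 A n x y p q = r13_r23 A n' x' y' p' q'"
    using key[OF r(1)] key[OF r(2)] by (simp_all add: fun_eq_iff)
qed

end

theory Submission
  imports Defs
begin

text \<open>
  Let \<open>e\<^sub>k\<close> be the given homogeneous basis of \<open>V\<close>, of parities \<open>|k|\<close>, and let \<open>g\<^sub>k\<close> be the image of the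
  dual vector \<open>e\<^sub>k\<^sup>*\<close> under the twist \<open>(\<beta>\<^sup>-\<^sup>1)\<^sup>*\<close> of \<open>V\<^sup>*\<close>. Put
  \<open>O(u, v) = T(u) T(v) - T(\<pi>(T(u)) v + (-1)\<^bsup>|u||v|\<^esup> \<pi>(T(v)) u)\<close>, so that \<open>T\<close> is an \<open>\<O>\<close>-operator
  exactly when \<open>O\<close> vanishes.

  The tensor \<open>r = T - \<sigma>(T)\<close> is always super skew-symmetric, because \<open>\<sigma>\<close> is an involution, and always
  fixed by the twist, because \<open>T \<beta> = \<alpha> T\<close> and the canonical tensor \<open>\<Sum> e\<^sub>k \<otimes> e\<^sub>k\<^sup>*\<close> does not depend on the
  basis. What remains is the Yang-Baxter equation. In the semi-direct product \<open>V\<^sup>* \<cdot> V\<^sup>* = 0\<close> and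
  \<open>\<J> \<cdot> V\<^sup>* \<subseteq> V\<^sup>*\<close>, so the Yang-Baxter expression of \<open>r\<close> has components only in
  \<open>\<J> \<otimes> V\<^sup>* \<otimes> V\<^sup>*\<close>, \<open>V\<^sup>* \<otimes> \<J> \<otimes> V\<^sup>*\<close> and \<open>V\<^sup>* \<otimes> V\<^sup>* \<otimes> \<J>\<close>. Each of them contains one term with the products
  \<open>T(e\<^sub>i) T(e\<^sub>j)\<close> and two terms in which \<open>T(e\<^sub>j)\<close> acts on a dual vector \<open>e\<^sub>i\<^sup>*\<close> while \<open>\<alpha>(T(e\<^sub>i))\<close> stands in
  another slot. Summing such a term over \<open>i\<close> moves the action from \<open>V\<^sup>*\<close> to \<open>V\<close>: by the definition of
  the dual module, \<open>e\<^sub>i\<^sup>* \<cdot> T(e\<^sub>j)\<close> takes the value \<open>e\<^sub>i\<^sup>*(\<beta>\<^sup>-\<^sup>1 \<pi>(T(e\<^sub>j)) e\<^sub>k)\<close> on \<open>\<beta> e\<^sub>k\<close>, so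
  \<open>\<Sum>\<^sub>i \<alpha>(T(e\<^sub>i)) \<otimes> (e\<^sub>i\<^sup>* \<cdot> T(e\<^sub>j)) = \<Sum>\<^sub>k \<alpha>(T(\<beta>\<^sup>-\<^sup>1 \<pi>(T(e\<^sub>j)) e\<^sub>k)) \<otimes> g\<^sub>k = \<Sum>\<^sub>k T(\<pi>(T(e\<^sub>j)) e\<^sub>k) \<otimes> g\<^sub>k\<close>.
  This is \<open>contraction_dual_prod\<close>. It turns the Yang-Baxter expression into
  \<open>\<Sum>\<^sub>i\<^sub>j \<plusminus> O(e\<^sub>i, e\<^sub>j) \<otimes> g\<^sub>i \<otimes> g\<^sub>j \<plusminus> g\<^sub>i \<otimes> O(e\<^sub>i, e\<^sub>j) \<otimes> g\<^sub>j \<plusminus> g\<^sub>i \<otimes> g\<^sub>j \<otimes> O(e\<^sub>i, e\<^sub>j)\<close>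
  (\<open>yang_baxter_contracted\<close>), which vanishes if and only if all \<open>O(e\<^sub>i, e\<^sub>j)\<close> do: for the converse, a
  coordinate of \<open>\<J>\<close> in the first slot and evaluations at \<open>\<beta> e\<^sub>i\<close>, \<open>\<beta> e\<^sub>j\<close> in the other two isolate one
  summand. Finally \<open>O\<close> is bilinear on homogeneous components, so it vanishes if it does on the basis.

  Tensors being functionals on multilinear forms, all identities between elements of the tensor cube
  are proved after evaluation at an arbitrary trilinear form \<open>C\<close>.
\<close>

section \<open>Bilinear extensions and semi-direct products\<close>

lemma vector_space_mult: "vector_space ((*) :: 'k::field \<Rightarrow> 'k \<Rightarrow> 'k)"
  by unfold_locales (simp_all add: algebra_simps)

lemma ksign_mult: "ksign (a + b) = ksign a * (ksign b :: 'k::ring_1)"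
  by (cases a; cases b) (simp_all add: ksign_def)

lemma ksign_square: "ksign a * ksign a = (1 :: 'k::ring_1)"
  by (simp add: ksign_def)

lemma even_linear_carrier:
  assumes "superspace W" "even_linear V W f" "superspace V" "x \<in> carrier V"
  shows "f x \<in> carrier W"
proof -
  obtain x0 x1 where *: "x = x0 + x1" "x0 \<in> grd V 0" "x1 \<in> grd V 1"
    using assms(4) by (auto simp: span_grd_def)
  then have "f x = f x0 + f x1"
    using assms grd_subset_carrier[OF assms(3)] by (simp add: even_linear_def linear_on_def)
  then show ?thesis using * assms(2) by (auto simp: even_linear_def span_grd_def)
qed

lemma linear_on_zero:
  assumes "linear_on S s t f" "module.subspace s S" "vector_space s"
  shows "f 0 = 0"
proof -
  interpret s: vector_space s by fact
  show ?thesis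
    using assms(1) s.subspace_0[OF assms(2)] by (metis linear_on_def add_cancel_right_left)
qed

lemma bilinear_on_zero:
  assumes "bilinear_on V W t F" "superspace V" "superspace W"
  shows "x \<in> carrier V \<Longrightarrow> F x 0 = 0" "y \<in> carrier W \<Longrightarrow> F 0 y = 0"
proof -
  have v: "vector_space (scl V)" "vector_space (scl W)"
    using assms by (simp_all add: superspace_def)
  show "F x 0 = 0" if "x \<in> carrier V"
    using assms(1) that linear_on_zero[OF _ subspace_carrier[OF assms(3)] v(2)]
    unfolding bilinear_on_def by blast
  show "F 0 y = 0" if "y \<in> carrier W"
    using assms(1) that linear_on_zero[where f = "\<lambda>x. F x y", OF _ subspace_carrier[OF assms(2)] v(1)]
    unfolding bilinear_on_def by blast
qed

lemma bilinear_on_hext: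
  assumes V: "superspace V" and W: "superspace W" and t: "vector_space t"
    and F: "\<And>a b. bilinear_on V W t (F a b)"
  shows "bilinear_on V W t (hext (grd V) (grd W) F)"
proof -
  interpret t: vector_space t by fact
  have c: "hpart (grd V) a x \<in> carrier V" if "x \<in> carrier V" for a x
    using hpart_carrier(1)[OF V that] grd_subset_carrier[OF V] by blast
  have d: "hpart (grd W) a x \<in> carrier W" if "x \<in> carrier W" for a x
    using hpart_carrier(1)[OF W that] grd_subset_carrier[OF W] by blast
  show ?thesis
    using F linear_on_hpart[OF V] linear_on_hpart[OF W] c d
    by (simp add: bilinear_on_def linear_on_def hext_def t.scale_right_distrib algebra_simps)
qed

text \<open>
  The summands in which one of the arguments is replaced by its component of the wrong parity,
  namely 0, vanish by bilinearity.
\<close>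

lemma hext_homogeneous:
  assumes V: "superspace V" and W: "superspace W" and F: "\<And>a b. bilinear_on V W t (F a b)"
    and x: "x \<in> grd V a" and y: "y \<in> grd W b"
  shows "hext (grd V) (grd W) F x y = F a b x y"
proof -
  have "0 \<in> carrier V"
    using module.subspace_0[OF _ subspace_carrier[OF V]] V by (simp add: superspace_def module_iff_vector_space)
  then have z: "F c d 0 y = 0" "F c d x 0 = 0" "F c d 0 0 = 0" for c d
    using bilinear_on_zero[OF F V W] grd_subset_carrier[OF V x] grd_subset_carrier[OF W y] by blast+
  show ?thesis
    by (cases a; cases b)
      (simp_all add: hext_def hpart_homogeneous[OF V x] hpart_homogeneous[OF W y] z)
qed

text \<open>
  The part of the structure of a Hom-superalgebra that the Yang-Baxter equation refers to.
\<close>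

definition graded_hom_algebra :: "('k::field, 'a::ab_group_add, 'm) hom_superalgebra_scheme \<Rightarrow> bool" where
  "graded_hom_algebra A \<longleftrightarrow>
     superspace A \<and> bilinear_on A A (scl A) (prd A) \<and>
     (\<forall>a b. \<forall>x\<in>grd A a. \<forall>y\<in>grd A b. prd A x y \<in> grd A (a + b)) \<and> even_linear A A (twist A)"

text \<open>
  The linear and parity conditions on a module. They pass to the dual module, and they make the
  semi-direct product a graded Hom-algebra in the above sense.
\<close>

definition graded_hom_module ::
  "('k::field, 'j::ab_group_add, 'm) hom_superalgebra_scheme \<Rightarrow>
   ('k, 'j, 'v::ab_group_add, 'n) hom_module_scheme \<Rightarrow> bool" where
  "graded_hom_module J M \<longleftrightarrow>
     superspace M \<and> bilinear_on J M (scl M) (act M) \<and>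
     (\<forall>a b. \<forall>x\<in>grd J a. \<forall>w\<in>grd M b. act M x w \<in> grd M (a + b)) \<and> even_linear M M (twist M)"

lemma span_grd_Times: "span_grd (\<lambda>a. G a \<times> H a) = span_grd G \<times> span_grd H"
  by (auto simp: span_grd_def)

context
  fixes J :: "('k::field, 'j::ab_group_add, 'm) hom_superalgebra_scheme"
    and M :: "('k, 'j, 'v::ab_group_add, 'n) hom_module_scheme"
  assumes J: "graded_hom_algebra J" and M: "graded_hom_module J M"
begin

lemma semidirect_simps:
  "scl (semidirect J M) c (x, w) = (scl J c x, scl M c w)"
  "grd (semidirect J M) a = grd J a \<times> grd M a"
  "twist (semidirect J M) (x, w) = (twist J x, twist M w)"
  "carrier (semidirect J M) = carrier J \<times> carrier M"
  by (simp_all add: semidirect_def Let_def span_grd_Times)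

lemma superspace_semidirect: "superspace (semidirect J M)"
proof -
  have J': "superspace J" and M': "superspace M"
    using J M by (simp_all add: graded_hom_algebra_def graded_hom_module_def)
  interpret j: vector_space "scl J" using J' by (simp add: superspace_def)
  interpret m: vector_space "scl M" using M' by (simp add: superspace_def)
  have v: "vector_space (scl (semidirect J M))"
    by unfold_locales
      (auto simp: semidirect_def Let_def j.scale_right_distrib j.scale_left_distrib
         m.scale_right_distrib m.scale_left_distrib)
  interpret a: vector_space "scl (semidirect J M)" by (rule v)
  have "j.subspace (grd J a)" "m.subspace (grd M a)" for a
    using J' M' by (simp_all add: superspace_def)
  then have "a.subspace (grd (semidirect J M) a)" for a
    unfolding j.subspace_def m.subspace_def a.subspace_def
    by (auto simp: semidirect_simps zero_prod_def)
  moreover have "grd (semidirect J M) 0 \<inter> grd (semidirect J M) 1 = {0}"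
    using J' M' by (auto simp: superspace_def semidirect_simps zero_prod_def Times_Int_Times)
  ultimately show ?thesis using v by (simp add: superspace_def)
qed

definition semidirect_form :: "bit \<Rightarrow> bit \<Rightarrow> 'j \<times> 'v \<Rightarrow> 'j \<times> 'v \<Rightarrow> 'j \<times> 'v" where
  "semidirect_form = (\<lambda>a b (x, u) (y, v).
     (prd J x y, act M x v + scl M (ksign (a * b)) (act M y u)))"

lemma bilinear_semidirect_form:
  "bilinear_on (semidirect J M) (semidirect J M) (scl (semidirect J M)) (semidirect_form a b)"
proof -
  interpret m: vector_space "scl M" using M by (simp add: superspace_def graded_hom_module_def)
  show ?thesis
    using J M
    by (auto simp: bilinear_on_def linear_on_def semidirect_simps semidirect_form_def
        graded_hom_algebra_def graded_hom_module_def m.scale_right_distrib algebra_simps)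
qed

lemma prd_semidirect:
  assumes "x \<in> grd J a" "w \<in> grd M a" "y \<in> grd J b" "z \<in> grd M b"
  shows "prd (semidirect J M) (x, w) (y, z) =
    (prd J x y, act M x z + scl M (ksign (a * b)) (act M y w))"
proof -
  have "prd (semidirect J M) = hext (grd (semidirect J M)) (grd (semidirect J M)) semidirect_form"
    by (simp add: semidirect_def Let_def semidirect_form_def)
  then show ?thesis
    using hext_homogeneous[OF superspace_semidirect superspace_semidirect bilinear_semidirect_form,
        of "(x, w)" a "(y, z)" b] assms
    by (simp add: semidirect_simps semidirect_form_def)
qed

lemma graded_hom_algebra_semidirect: "graded_hom_algebra (semidirect J M)"
proof -
  have M': "superspace M" using M by (simp add: graded_hom_module_def)
  interpret m: vector_space "scl M" using M' by (simp add: superspace_def)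
  note W = superspace_semidirect
  have "prd (semidirect J M) = hext (grd (semidirect J M)) (grd (semidirect J M)) semidirect_form"
    by (simp add: semidirect_def Let_def semidirect_form_def)
  then have b: "bilinear_on (semidirect J M) (semidirect J M) (scl (semidirect J M)) (prd (semidirect J M))"
    using bilinear_on_hext[OF W W _ bilinear_semidirect_form] W by (simp add: superspace_def)
  have "prd (semidirect J M) x y \<in> grd (semidirect J M) (a + b)"
    if xy: "x \<in> grd (semidirect J M) a" "y \<in> grd (semidirect J M) b" for x y a b
  proof -
    obtain x0 w y0 z where *: "x = (x0, w)" "y = (y0, z)"
      "x0 \<in> grd J a" "w \<in> grd M a" "y0 \<in> grd J b" "z \<in> grd M b"
      using xy by (cases x; cases y) (auto simp: semidirect_simps)
    have g: "act M x0 z \<in> grd M (a + b)" "act M y0 w \<in> grd M (b + a)" "prd J x0 y0 \<in> grd J (a + b)"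
      using * J M unfolding graded_hom_algebra_def graded_hom_module_def by blast+
    have "m.subspace (grd M (a + b))" using M' by (simp add: superspace_def)
    then have "act M x0 z + scl M (ksign (a * b)) (act M y0 w) \<in> grd M (a + b)"
      using g m.subspace_add m.subspace_scale by (metis add.commute)
    then show ?thesis using g by (simp add: * prd_semidirect[OF *(3-6)] semidirect_simps)
  qed
  moreover have "even_linear (semidirect J M) (semidirect J M) (twist (semidirect J M))"
    using J M by (auto simp: even_linear_def linear_on_def semidirect_simps
        graded_hom_algebra_def graded_hom_module_def)
  ultimately show ?thesis using W b by (simp add: graded_hom_algebra_def)
qed

end

section \<open>The dual module\<close>

locale dualizable_module =
  fixes J :: "('k::field, 'j::ab_group_add) hom_superalgebra"
    and M :: "('k, 'j, 'v::ab_group_add) hom_module"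
  assumes J: "graded_hom_algebra J" and M: "graded_hom_module J M"
    and bij: "bij_betw (twist M) (carrier M) (carrier M)"
    and twist_act: "\<And>a x w. x \<in> grd J a \<Longrightarrow> w \<in> carrier M \<Longrightarrow>
      twist M (act M x w) = act M (twist J x) (twist M w)"
begin

lemma superspace_J: "superspace J" and superspace_M: "superspace M"
  using J M by (simp_all add: graded_hom_algebra_def graded_hom_module_def)

sublocale j: vector_space "scl J"
  using superspace_J by (simp add: superspace_def)

sublocale m: vector_space "scl M"
  using superspace_M by (simp add: superspace_def)

abbreviation D where "D \<equiv> dual_module J M"

abbreviation inv_twist where "inv_twist \<equiv> inv_into (carrier M) (twist M)"

lemma dual_simps:
  "scl D = fun_scale" "grd D = dual_grd M" "twist D = dual_map M inv_twist"
  "act D x \<xi> = dual_act J M (twist J x) (dual_map M (inv_twist \<circ> inv_twist) \<xi>)"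
  by (simp_all add: dual_module_def Let_def)

lemma carrier_M: "x \<in> grd M a \<Longrightarrow> x \<in> carrier M" "0 \<in> carrier M"
  "x \<in> carrier M \<Longrightarrow> y \<in> carrier M \<Longrightarrow> x + y \<in> carrier M" "x \<in> carrier M \<Longrightarrow> scl M c x \<in> carrier M"
  using grd_subset_carrier[OF superspace_M] subspace_carrier[OF superspace_M]
    m.subspace_add m.subspace_scale m.subspace_0 by blast+

lemma carrier_J: "x \<in> grd J a \<Longrightarrow> x \<in> carrier J" "0 \<in> carrier J"
  "x \<in> carrier J \<Longrightarrow> y \<in> carrier J \<Longrightarrow> x + y \<in> carrier J" "x \<in> carrier J \<Longrightarrow> scl J c x \<in> carrier J"
  using grd_subset_carrier[OF superspace_J] subspace_carrier[OF superspace_J]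
    j.subspace_add j.subspace_scale j.subspace_0 by blast+

lemma even_twist: "even_linear M M (twist M)" "even_linear J J (twist J)"
  using J M by (simp_all add: graded_hom_algebra_def graded_hom_module_def)

lemma twist_carrier: "w \<in> carrier M \<Longrightarrow> twist M w \<in> carrier M" "x \<in> carrier J \<Longrightarrow> twist J x \<in> carrier J"
  using even_linear_carrier even_twist superspace_M superspace_J by blast+

lemma inv_twist:
  "w \<in> carrier M \<Longrightarrow> inv_twist (twist M w) = w"
  "w \<in> carrier M \<Longrightarrow> twist M (inv_twist w) = w"
  "w \<in> carrier M \<Longrightarrow> inv_twist w \<in> carrier M"
  using bij by (auto simp: bij_betw_def inv_into_f_f f_inv_into_f inv_into_into)

text \<open>
  The twist maps the components of \<open>\<beta>\<^sup>-\<^sup>1 w\<close> of parities \<open>a\<close> and \<open>a + 1\<close> to elements of these parities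
  that add up to \<open>w\<close>. If \<open>w\<close> has parity \<open>a\<close>, the second one is 0, and \<open>\<beta>\<^sup>-\<^sup>1 w\<close> equals its
  component of parity \<open>a\<close> by injectivity.
\<close>

lemma even_linear_inv_twist: "even_linear M M inv_twist"
proof -
  have "inv_twist w \<in> grd M a" if w: "w \<in> grd M a" for a w
  proof -
    let ?z = "inv_twist w" and ?h = "hpart (grd M)"
    have z: "?z \<in> carrier M" "twist M ?z = w" using w inv_twist carrier_M by auto
    have h: "?h b ?z \<in> grd M b" for b using hpart_carrier(1)[OF superspace_M z(1)] .
    have "?h a ?z + ?h (a + 1) ?z = ?z"
      using hpart_carrier(3)[OF superspace_M z(1)] by (cases a) (simp_all add: add.commute)
    moreover have tw: "twist M (?h b ?z) \<in> grd M b" for b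
      using h even_twist by (simp add: even_linear_def)
    ultimately have s: "w = twist M (?h a ?z) + twist M (?h (a + 1) ?z)"
      using z even_twist h carrier_M unfolding even_linear_def linear_on_def by metis
    have sub: "m.subspace (grd M a)" using superspace_M by (simp add: superspace_def)
    have "w - twist M (?h a ?z) \<in> grd M a" using m.subspace_diff[OF sub w tw] .
    then have "twist M (?h (a + 1) ?z) \<in> grd M a" using s by (metis add_diff_cancel_left')
    then have "twist M (?h (a + 1) ?z) \<in> grd M 0 \<inter> grd M 1"
      using tw[of "a + 1"] by (cases a) simp_all
    then have "twist M (?h (a + 1) ?z) = 0" using superspace_M by (auto simp: superspace_def)
    then have "w = twist M (?h a ?z)" using s by simp
    then show ?thesis using inv_twist h carrier_M by metis
  qed
  moreover have "inv_twist (x + y) = inv_twist x + inv_twist y" if "x \<in> carrier M" "y \<in> carrier M" for x y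
  proof -
    have "twist M (inv_twist x + inv_twist y) = x + y"
      using that inv_twist even_twist by (simp add: even_linear_def linear_on_def)
    then show ?thesis using that inv_twist carrier_M by metis
  qed
  moreover have "inv_twist (scl M c x) = scl M c (inv_twist x)" if "x \<in> carrier M" for c x
  proof -
    have "twist M (scl M c (inv_twist x)) = scl M c x"
      using that inv_twist even_twist by (simp add: even_linear_def linear_on_def)
    then show ?thesis using that inv_twist carrier_M by metis
  qed
  ultimately show ?thesis by (simp add: even_linear_def linear_on_def)
qed

text \<open>
  Every linear form is the sum of its compositions with the two parity projections, so the
  homogeneous forms span the full dual.
\<close>

lemma carrier_dual:
  "\<xi> \<in> carrier D \<longleftrightarrow> linear_on (carrier M) (scl M) (*) \<xi> \<and> (\<forall>w. w \<notin> carrier M \<longrightarrow> \<xi> w = 0)"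
proof
  assume "\<xi> \<in> carrier D"
  then obtain \<xi>0 \<xi>1 where "\<xi> = \<xi>0 + \<xi>1" "\<xi>0 \<in> dual_grd M 0" "\<xi>1 \<in> dual_grd M 1"
    by (auto simp: span_grd_def dual_simps)
  then show "linear_on (carrier M) (scl M) (*) \<xi> \<and> (\<forall>w. w \<notin> carrier M \<longrightarrow> \<xi> w = 0)"
    by (auto simp: dual_grd_def linear_on_def algebra_simps)
next
  assume \<xi>: "linear_on (carrier M) (scl M) (*) \<xi> \<and> (\<forall>w. w \<notin> carrier M \<longrightarrow> \<xi> w = 0)"
  define \<eta> where "\<eta> a w = (if w \<in> carrier M then \<xi> (hpart (grd M) a w) else 0)" for a w
  have h: "hpart (grd M) a w \<in> carrier M" if "w \<in> carrier M" for a w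
    using hpart_carrier(1)[OF superspace_M that] carrier_M by blast
  have \<xi>0: "\<xi> 0 = 0"
    using linear_on_zero[OF _ subspace_carrier[OF superspace_M] m.vector_space_axioms] \<xi> by blast
  have \<eta>: "\<eta> a \<in> dual_grd M a" for a
    using \<xi> linear_on_hpart[OF superspace_M] h \<xi>0
    by (cases a) (auto simp: dual_grd_def linear_on_def \<eta>_def carrier_M hpart_homogeneous[OF superspace_M])
  moreover have "\<xi> = \<eta> 0 + \<eta> 1"
  proof
    fix w
    show "\<xi> w = (\<eta> 0 + \<eta> 1) w"
    proof (cases "w \<in> carrier M")
      case True
      then have "\<xi> (hpart (grd M) 0 w + hpart (grd M) 1 w) = \<eta> 0 w + \<eta> 1 w"
        using \<xi> h by (simp add: \<eta>_def linear_on_def)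
      then show ?thesis using hpart_carrier(3)[OF superspace_M True] by simp
    qed (use \<xi> in \<open>simp add: \<eta>_def\<close>)
  qed
  ultimately show "\<xi> \<in> carrier D" by (auto simp: span_grd_def dual_simps)
qed

lemma superspace_dual: "superspace D"
proof -
  interpret f: vector_space "fun_scale :: 'k \<Rightarrow> ('v \<Rightarrow> 'k) \<Rightarrow> _" by (rule vector_space_fun_scale)
  have "f.subspace (dual_grd M a)" for a
    unfolding f.subspace_def
    by (auto simp: dual_grd_def linear_on_def fun_scale_def algebra_simps)
  moreover have "dual_grd M 0 \<inter> dual_grd M 1 = {0}"
  proof -
    have "\<xi> = 0" if \<xi>: "\<xi> \<in> dual_grd M 0" "\<xi> \<in> dual_grd M 1" for \<xi>
    proof
      fix w
      show "\<xi> w = 0 w"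
      proof (cases "w \<in> carrier M")
        case True
        then obtain w0 w1 where "w = w0 + w1" "w0 \<in> grd M 0" "w1 \<in> grd M 1"
          by (auto simp: span_grd_def)
        then show ?thesis using \<xi> carrier_M by (auto simp: dual_grd_def linear_on_def)
      qed (use \<xi> in \<open>simp add: dual_grd_def\<close>)
    qed
    moreover have "0 \<in> dual_grd M a" for a by (auto simp: dual_grd_def linear_on_def)
    ultimately show ?thesis by blast
  qed
  ultimately show ?thesis
    using f.vector_space_axioms by (simp add: superspace_def dual_simps)
qed

lemma even_linear_dual_map:
  assumes "even_linear M M f"
  shows "even_linear D D (dual_map M f)"
  using assms even_linear_carrier[OF superspace_M assms superspace_M]
  by (auto simp: even_linear_def dual_simps dual_grd_def linear_on_def dual_map_def carrier_M
      fun_scale_def fun_eq_iff)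

lemma act_simps:
  assumes "x \<in> carrier J" "w \<in> carrier M"
  shows "act M x w \<in> carrier M"
    "x' \<in> carrier J \<Longrightarrow> act M (x + x') w = act M x w + act M x' w"
    "w' \<in> carrier M \<Longrightarrow> act M x (w + w') = act M x w + act M x w'"
    "act M (scl J c x) w = scl M c (act M x w)" "act M x (scl M c w) = scl M c (act M x w)"
proof -
  have b: "bilinear_on J M (scl M) (act M)" using M by (simp add: graded_hom_module_def)
  show add: "x' \<in> carrier J \<Longrightarrow> act M (x + x') w = act M x w + act M x' w"
    "w' \<in> carrier M \<Longrightarrow> act M x (w + w') = act M x w + act M x w'"
    "act M (scl J c x) w = scl M c (act M x w)" "act M x (scl M c w) = scl M c (act M x w)"
    using b assms by (auto simp: bilinear_on_def linear_on_def)
  obtain x0 x1 where x: "x = x0 + x1" "x0 \<in> grd J 0" "x1 \<in> grd J 1"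
    using assms by (auto simp: span_grd_def)
  obtain w0 w1 where w: "w = w0 + w1" "w0 \<in> grd M 0" "w1 \<in> grd M 1"
    using assms by (auto simp: span_grd_def)
  have "act M y z \<in> carrier M" if "y \<in> grd J a" "z \<in> grd M b" for y z a b
    using that M carrier_M(1) unfolding graded_hom_module_def by blast
  moreover have "act M x w = act M x0 w0 + act M x0 w1 + (act M x1 w0 + act M x1 w1)"
    using x w b carrier_M(1) carrier_J(1) assms by (simp add: bilinear_on_def linear_on_def)
  ultimately show "act M x w \<in> carrier M"
    using x w carrier_M(3) by simp
qed

lemma form_simps:
  assumes "\<xi> \<in> carrier D" "w \<in> carrier M"
  shows "w' \<in> carrier M \<Longrightarrow> \<xi> (w + w') = \<xi> w + \<xi> w'" "\<xi> (scl M c w) = c * \<xi> w"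
  using assms by (simp_all add: carrier_dual linear_on_def)

lemma bilinear_dual_form:
  "bilinear_on J D (scl D) (\<lambda>x \<xi>. fun_scale (ksign (a * b)) (dual_map M (act M x) \<xi>))"
  unfolding bilinear_on_def linear_on_def
  by (simp add: dual_simps(1) fun_scale_def dual_map_def fun_eq_iff act_simps form_simps
      algebra_simps)

lemma dual_act_homogeneous:
  assumes "x \<in> grd J a" "\<xi> \<in> dual_grd M b"
  shows "dual_act J M x \<xi> = fun_scale (ksign (a * b)) (dual_map M (act M x) \<xi>)"
  using hext_homogeneous[OF superspace_J superspace_dual bilinear_dual_form, of x a \<xi> b] assms
  by (simp add: dual_act_def dual_simps)

lemma dual_form_grd:
  assumes x: "x \<in> grd J a" and \<xi>: "\<xi> \<in> dual_grd M b"
  shows "fun_scale c (dual_map M (act M x) \<xi>) \<in> dual_grd M (a + b)"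
proof -
  have "act M x w \<in> grd M (b + 1)" if "w \<in> grd M (a + b + 1)" for w
  proof -
    have "act M x w \<in> grd M (a + (a + b + 1))"
      using that x M unfolding graded_hom_module_def by blast
    then show ?thesis by (cases a) simp_all
  qed
  then have "fun_scale c (dual_map M (act M x) \<xi>) w = 0" if "w \<in> grd M (a + b + 1)" for w
    using that \<xi> by (simp add: fun_scale_def dual_map_def dual_grd_def)
  moreover have "\<xi> \<in> carrier D"
    using grd_subset_carrier[OF superspace_dual] \<xi> by (simp add: dual_simps)
  ultimately show ?thesis
    using carrier_J(1)[OF x]
    by (auto simp: dual_grd_def linear_on_def fun_scale_def dual_map_def carrier_M act_simps
        form_simps algebra_simps)
qed

lemma graded_hom_module_dual: "graded_hom_module J D"
proof -
  let ?i = "inv_twist \<circ> inv_twist"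
  have i2: "even_linear M M ?i"
    using even_linear_inv_twist by (simp add: even_linear_def linear_on_def inv_twist)
  have d: "even_linear D D (dual_map M ?i)" by (rule even_linear_dual_map[OF i2])
  have "bilinear_on J D (scl D) (dual_act J M)"
    using bilinear_on_hext[OF superspace_J superspace_dual _ bilinear_dual_form] superspace_dual
    by (simp add: dual_act_def superspace_def dual_simps)
  then have "bilinear_on J D (scl D) (act D)"
    using d even_twist(2) even_linear_carrier[OF superspace_dual d superspace_dual] twist_carrier(2)
    by (simp add: bilinear_on_def dual_simps(4) even_linear_def linear_on_def)
  moreover have "act D x \<xi> \<in> grd D (a + b)" if x: "x \<in> grd J a" and \<xi>: "\<xi> \<in> grd D b" for a b x \<xi>
  proof -
    let ?\<eta> = "dual_map M ?i \<xi>"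
    have tx: "twist J x \<in> grd J a" using x even_twist by (simp add: even_linear_def)
    have \<eta>: "?\<eta> \<in> dual_grd M b" using \<xi> d by (simp add: even_linear_def dual_simps)
    show ?thesis
      unfolding dual_simps dual_act_homogeneous[OF tx \<eta>] by (rule dual_form_grd[OF tx \<eta>])
  qed
  moreover have "even_linear D D (twist D)"
    using even_linear_dual_map[OF even_linear_inv_twist] by (simp add: dual_simps)
  ultimately show ?thesis using superspace_dual by (simp add: graded_hom_module_def)
qed

text \<open>
  Evaluation at \<open>\<beta> w\<close> absorbs one of the two factors \<open>\<beta>\<^sup>-\<^sup>1\<close> in the dual action together with the
  twist of \<open>x\<close>, because \<open>\<pi>(\<alpha>(x)) \<beta> = \<beta> \<pi>(x)\<close>. This is why dual elements are always evaluated at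
  twisted vectors below.
\<close>

lemma act_dual_twist:
  assumes "x \<in> grd J a" "\<xi> \<in> grd D b" "w \<in> carrier M"
  shows "act D x \<xi> (twist M w) = ksign (a * b) * \<xi> (inv_twist (act M x w))"
proof -
  let ?i = "inv_twist \<circ> inv_twist"
  have i2: "even_linear M M ?i"
    using even_linear_inv_twist by (simp add: even_linear_def linear_on_def inv_twist)
  have tx: "twist J x \<in> grd J a" using assms even_twist by (simp add: even_linear_def)
  have \<eta>: "dual_map M ?i \<xi> \<in> dual_grd M b"
    using assms even_linear_dual_map[OF i2] by (simp add: even_linear_def dual_simps)
  have c: "act M (twist J x) (twist M w) \<in> carrier M" "act M x w \<in> carrier M"
    using act_simps(1)[OF carrier_J(1)[OF tx] twist_carrier(1)[OF assms(3)]]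
      act_simps(1)[OF carrier_J(1)[OF assms(1)] assms(3)] by simp_all
  show ?thesis
    unfolding dual_simps dual_act_homogeneous[OF tx \<eta>] fun_scale_def
    using c assms(3) inv_twist
    by (simp add: dual_map_def twist_carrier
        flip: twist_act[OF assms(1,3)])
qed

lemma twist_dual_twist:
  "w \<in> carrier M \<Longrightarrow> twist D \<xi> (twist M w) = \<xi> w"
  by (simp add: dual_simps dual_map_def inv_twist twist_carrier)

end

section \<open>The Yang-Baxter equation for skew tensors\<close>

text \<open>
  The value at \<open>C\<close> of the contribution of the pure tensors \<open>x \<otimes> y\<close> and \<open>x' \<otimes> y'\<close> to
  \<open>r\<^sub>1\<^sub>2 \<cdot> r\<^sub>1\<^sub>3 - r\<^sub>1\<^sub>2 \<cdot> r\<^sub>2\<^sub>3 + r\<^sub>1\<^sub>3 \<cdot> r\<^sub>2\<^sub>3\<close>. A single parity per tensor suffices since the tensors of interest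
  are even, so that both factors have the same parity.
\<close>

definition yang_baxter_summand ::
  "('k::field, 'a::ab_group_add, 'm) hom_superalgebra_scheme \<Rightarrow> ('a \<Rightarrow> 'a \<Rightarrow> 'a \<Rightarrow> 'k) \<Rightarrow>
   bit \<Rightarrow> 'a \<Rightarrow> 'a \<Rightarrow> bit \<Rightarrow> 'a \<Rightarrow> 'a \<Rightarrow> 'k" where
  "yang_baxter_summand A C a x y b x' y' =
     ksign (b * a) * C (prd A x x') (twist A y) (twist A y')
     - C (twist A x) (prd A y x') (twist A y')
     + ksign (b * a) * C (twist A x) (twist A x') (prd A y y')"

lemma graded_hom_algebra_carrier:
  assumes A: "graded_hom_algebra A"
  shows "x \<in> carrier A \<Longrightarrow> twist A x \<in> carrier A"
    and "x \<in> carrier A \<Longrightarrow> y \<in> carrier A \<Longrightarrow> prd A x y \<in> carrier A"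
proof -
  have W: "superspace A" and b: "bilinear_on A A (scl A) (prd A)"
    using A by (simp_all add: graded_hom_algebra_def)
  interpret w: vector_space "scl A" using W by (simp add: superspace_def)
  show "x \<in> carrier A \<Longrightarrow> twist A x \<in> carrier A"
    using even_linear_carrier[OF W _ W] A by (simp add: graded_hom_algebra_def)
  assume xy: "x \<in> carrier A" "y \<in> carrier A"
  obtain x0 x1 where x: "x = x0 + x1" "x0 \<in> grd A 0" "x1 \<in> grd A 1"
    using xy by (auto simp: span_grd_def)
  obtain y0 y1 where y: "y = y0 + y1" "y0 \<in> grd A 0" "y1 \<in> grd A 1"
    using xy by (auto simp: span_grd_def)
  note g = grd_subset_carrier[OF W]
  have "prd A u v \<in> carrier A" if "u \<in> grd A a" "v \<in> grd A b" for u v a b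
    using that A g unfolding graded_hom_algebra_def by blast
  moreover have "prd A x y = prd A x0 y0 + prd A x0 y1 + (prd A x1 y0 + prd A x1 y1)"
    using x y b g xy by (simp add: bilinear_on_def linear_on_def)
  ultimately show "prd A x y \<in> carrier A"
    using x y w.subspace_add[OF subspace_carrier[OF W]] by metis
qed

lemma yang_baxter_summand_scale:
  assumes A: "graded_hom_algebra A" and C: "trilinear_on A (*) C"
    and "x \<in> carrier A" "y \<in> carrier A" "x' \<in> carrier A" "y' \<in> carrier A"
  shows "yang_baxter_summand A C a (scl A c x) y b x' y' = c * yang_baxter_summand A C a x y b x' y'"
    and "yang_baxter_summand A C a x y b (scl A c x') y' = c * yang_baxter_summand A C a x y b x' y'"
proof -
  note * = graded_hom_algebra_carrier[OF A]
  have t: "twist A (scl A c v) = scl A c (twist A v)" if "v \<in> carrier A" for v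
    using A that by (simp add: graded_hom_algebra_def even_linear_def linear_on_def)
  have p: "prd A (scl A c v) w = scl A c (prd A v w)" "prd A v (scl A c w) = scl A c (prd A v w)"
    if "v \<in> carrier A" "w \<in> carrier A" for v w
    using A that by (simp_all add: graded_hom_algebra_def bilinear_on_def linear_on_def)
  have C': "C (scl A c u) v w = c * C u v w" "C u (scl A c v) w = c * C u v w"
    "C u v (scl A c w) = c * C u v w"
    if "u \<in> carrier A" "v \<in> carrier A" "w \<in> carrier A" for u v w
    using C that by (simp_all add: trilinear_on_def linear_on_def)
  show "yang_baxter_summand A C a (scl A c x) y b x' y' = c * yang_baxter_summand A C a x y b x' y'"
    "yang_baxter_summand A C a x y b (scl A c x') y' = c * yang_baxter_summand A C a x y b x' y'"
    using assms(3-) by (simp_all add: yang_baxter_summand_def t p C' * algebra_simps)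
qed

lemma tensor_square_presentation:
  assumes "superspace A" "homogeneous_presentation A r n x y p q"
  shows "r \<in> tensor_square A"
proof -
  interpret f: vector_space fun_scale by (rule vector_space_fun_scale)
  have "tensor2 A (x i) (y i) \<in> tensor_square A" if "i < n" for i
    using that assms(2) grd_subset_carrier[OF assms(1)]
    unfolding tensor_square_def homogeneous_presentation_def by (intro f.span_base) blast
  then show ?thesis
    using assms(2) by (auto simp: homogeneous_presentation_def tensor_square_def intro!: f.span_sum)
qed

text \<open>
  The three products do not depend on the presentation, so the equation may be tested on one
  presentation; a functional on trilinear forms is 0 if it vanishes at each of them.
\<close>

lemma super_HJYBE_solution_presentation:
  fixes A :: "('k::field, 'a::ab_group_add, 'm) hom_superalgebra_scheme"
  assumes A: "graded_hom_algebra A" and r: "homogeneous_presentation A r n x y d d"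
  shows "super_HJYBE_solution A r \<longleftrightarrow> tensor_twist A r = r \<and>
    (\<forall>C. trilinear_on A (*) C \<longrightarrow>
      (\<Sum>i<n. \<Sum>j<n. yang_baxter_summand A C (d i) (x i) (y i) (d j) (x j) (y j)) = 0)"
proof -
  have W: "superspace A" using A by (simp add: graded_hom_algebra_def)
  define Y where "Y = r12_r13 A n x y d d - r12_r23 A n x y + r13_r23 A n x y d d"
  have "r12_r13 A n' x' y' p q - r12_r23 A n' x' y' + r13_r23 A n' x' y' p q = Y"
    if "homogeneous_presentation A r n' x' y' p q" for n' x' y' p q
    using presentation_independent[OF W _ _ _ that r] A
    by (simp add: graded_hom_algebra_def Y_def)
  then have "super_HJYBE_solution A r \<longleftrightarrow> tensor_twist A r = r \<and> Y = 0"
    using r tensor_square_presentation[OF W r] unfolding super_HJYBE_solution_def by metis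
  moreover have "Y C = (if trilinear_on A (*) C then
      \<Sum>i<n. \<Sum>j<n. yang_baxter_summand A C (d i) (x i) (y i) (d j) (x j) (y j) else 0)" for C
    by (simp add: Y_def r12_r13_def r12_r23_def r13_r23_def sum_fun_apply fun_scale_def tensor3_def
        yang_baxter_summand_def sum.distrib sum_subtractf)
  then have "Y = 0 \<longleftrightarrow> (\<forall>C. trilinear_on A (*) C \<longrightarrow>
      (\<Sum>i<n. \<Sum>j<n. yang_baxter_summand A C (d i) (x i) (y i) (d j) (x j) (y j)) = 0)"
    by (auto simp: fun_eq_iff)
  ultimately show ?thesis by simp
qed

lemma sum_lessThan_double: "(\<Sum>i<n + n. f i) = (\<Sum>i<n. f i + f (n + i))"
  for f :: "nat \<Rightarrow> 'a::comm_monoid_add"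
proof -
  have "(\<Sum>i<n + m. f i) = (\<Sum>i<n. f i) + (\<Sum>i<m. f (n + i))" for m
    by (induction m) (simp_all add: add.assoc)
  then show ?thesis by (simp add: sum.distrib)
qed

text \<open>
  Both factors of each summand have parity \<open>d i\<close>, so swapping twice contributes the sign
  \<open>ksign (d i) * ksign (d i) = 1\<close>.
\<close>

lemma tensor_swap_skew:
  assumes "superspace A" "finite I"
    "\<And>i. i \<in> I \<Longrightarrow> x i \<in> grd A (d i)" "\<And>i. i \<in> I \<Longrightarrow> y i \<in> grd A (d i)"
  shows "tensor_swap A (\<Sum>i\<in>I. tensor2 A (x i) (y i)) =
    (\<Sum>i\<in>I. fun_scale (ksign (d i)) (tensor2 A (y i) (x i)))"
    "tensor_swap A (\<Sum>i\<in>I. fun_scale (ksign (d i)) (tensor2 A (y i) (x i))) =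
      (\<Sum>i\<in>I. tensor2 A (x i) (y i))"
proof -
  interpret f: vector_space fun_scale by (rule vector_space_fun_scale)
  have l: "tensor_swap A 0 = 0" "tensor_swap A (r + r') = tensor_swap A r + tensor_swap A r'"
    "tensor_swap A (fun_scale c r) = fun_scale c (tensor_swap A r)" for r r' c
    unfolding tensor_swap_def by (simp_all add: tensor_lift_linear) (simp add: tensor_lift_def fun_eq_iff)
  have *: "tensor_swap A (tensor2 A (x i) (y i)) = fun_scale (ksign (d i)) (tensor2 A (y i) (x i))"
     "tensor_swap A (tensor2 A (y i) (x i)) = fun_scale (ksign (d i)) (tensor2 A (x i) (y i))"
    if "i \<in> I" for i
    using tensor_swap_tensor2[OF assms(1) assms(3)[OF that] assms(4)[OF that]]
      tensor_swap_tensor2[OF assms(1) assms(4)[OF that] assms(3)[OF that]]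
    by (cases "d i"; simp)+
  show "tensor_swap A (\<Sum>i\<in>I. tensor2 A (x i) (y i)) =
    (\<Sum>i\<in>I. fun_scale (ksign (d i)) (tensor2 A (y i) (x i)))"
    using assms(2) * by (induction) (simp_all add: l)
  show "tensor_swap A (\<Sum>i\<in>I. fun_scale (ksign (d i)) (tensor2 A (y i) (x i))) =
      (\<Sum>i\<in>I. tensor2 A (x i) (y i))"
    using assms(2) * by (induction) (simp_all add: l ksign_square)
qed

text \<open>
  A presentation carries no coefficients, so the sign of a swapped summand is absorbed into its left
  factor.
\<close>

lemma skew_presentation:
  fixes A :: "('k::field, 'a::ab_group_add, 'm) hom_superalgebra_scheme"
  assumes W: "superspace A"
    and x: "\<And>i. i < n \<Longrightarrow> x i \<in> grd A (d i)" and y: "\<And>i. i < n \<Longrightarrow> y i \<in> grd A (d i)"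
  defines "X \<equiv> \<lambda>i. if i < n then x i else scl A (- ksign (d (i - n))) (y (i - n))"
    and "Y \<equiv> \<lambda>i. if i < n then y i else x (i - n)"
  shows "homogeneous_presentation A
    ((\<Sum>i<n. tensor2 A (x i) (y i)) - (\<Sum>i<n. fun_scale (ksign (d i)) (tensor2 A (y i) (x i))))
    (n + n) X Y (\<lambda>i. if i < n then d i else d (i - n)) (\<lambda>i. if i < n then d i else d (i - n))"
proof -
  interpret w: vector_space "scl A" using W by (simp add: superspace_def)
  have "X i \<in> grd A (if i < n then d i else d (i - n)) \<and> Y i \<in> grd A (if i < n then d i else d (i - n))"
    if "i < n + n" for i
  proof (cases "i < n")
    case False
    then have "i - n < n" using that by simp
    moreover have "w.subspace (grd A (d (i - n)))" using W by (simp add: superspace_def)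
    ultimately show ?thesis
      using False x y w.subspace_scale unfolding X_def Y_def by (auto simp del: w.scale_minus_left)
  qed (simp add: X_def Y_def x y)
  moreover have "tensor2 A (scl A (- ksign (d i)) (y i)) (x i) = - fun_scale (ksign (d i)) (tensor2 A (y i) (x i))"
    if "i < n" for i
  proof -
    have "tensor2 A (scl A (- ksign (d i)) (y i)) (x i) = fun_scale (- ksign (d i)) (tensor2 A (y i) (x i))"
      using grd_subset_carrier[OF W x[OF that]] grd_subset_carrier[OF W y[OF that]]
        bilinear_on_tensor2[of A] unfolding bilinear_on_def linear_on_def by blast
    then show ?thesis by (simp add: fun_scale_def fun_eq_iff)
  qed
  then have "(\<Sum>i<n + n. tensor2 A (X i) (Y i)) =
    (\<Sum>i<n. tensor2 A (x i) (y i)) - (\<Sum>i<n. fun_scale (ksign (d i)) (tensor2 A (y i) (x i)))"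
    by (simp add: sum_lessThan_double X_def Y_def sum_subtractf del: w.scale_minus_left)
  ultimately show ?thesis unfolding homogeneous_presentation_def by simp
qed

text \<open>
  Expansion of the double sum for \<open>r - \<sigma>(r)\<close>: each of the two indices selects a summand or its swap.
\<close>

lemma super_HJYBE_solution_skew:
  fixes A :: "('k::field, 'a::ab_group_add, 'm) hom_superalgebra_scheme" and n :: nat
  assumes A: "graded_hom_algebra A"
    and x: "\<And>i. i < n \<Longrightarrow> x i \<in> grd A (d i)" and y: "\<And>i. i < n \<Longrightarrow> y i \<in> grd A (d i)"
  defines "r \<equiv> (\<Sum>i<n. tensor2 A (x i) (y i)) - (\<Sum>i<n. fun_scale (ksign (d i)) (tensor2 A (y i) (x i)))"
  shows "super_HJYBE_solution A r \<longleftrightarrow> tensor_twist A r = r \<and>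
    (\<forall>C. trilinear_on A (*) C \<longrightarrow> (\<Sum>i<n. \<Sum>j<n.
       yang_baxter_summand A C (d i) (x i) (y i) (d j) (x j) (y j)
       - ksign (d j) * yang_baxter_summand A C (d i) (x i) (y i) (d j) (y j) (x j)
       - ksign (d i) * yang_baxter_summand A C (d i) (y i) (x i) (d j) (x j) (y j)
       + ksign (d i) * ksign (d j) * yang_baxter_summand A C (d i) (y i) (x i) (d j) (y j) (x j)) = 0)"
proof -
  have W: "superspace A" using A by (simp add: graded_hom_algebra_def)
  interpret w: vector_space "scl A" using W by (simp add: superspace_def)
  have c: "x i \<in> carrier A" "y i \<in> carrier A" "scl A c (y i) \<in> carrier A" if "i < n" for i c
    using grd_subset_carrier[OF W] x[OF that] y[OF that] w.subspace_scale[OF subspace_carrier[OF W]] by blast+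
  define X where "X i = (if i < n then x i else scl A (- ksign (d (i - n))) (y (i - n)))" for i
  define Y where "Y i = (if i < n then y i else x (i - n))" for i
  define d' where "d' i = (if i < n then d i else d (i - n))" for i
  have p: "homogeneous_presentation A r (n + n) X Y d' d'"
    unfolding r_def X_def Y_def d'_def by (rule skew_presentation[OF W x y])
  have "(\<Sum>i<n + n. \<Sum>j<n + n. yang_baxter_summand A C (d' i) (X i) (Y i) (d' j) (X j) (Y j)) =
    (\<Sum>i<n. \<Sum>j<n.
       yang_baxter_summand A C (d i) (x i) (y i) (d j) (x j) (y j)
       - ksign (d j) * yang_baxter_summand A C (d i) (x i) (y i) (d j) (y j) (x j)
       - ksign (d i) * yang_baxter_summand A C (d i) (y i) (x i) (d j) (x j) (y j)
       + ksign (d i) * ksign (d j) * yang_baxter_summand A C (d i) (y i) (x i) (d j) (y j) (x j))"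
    if C: "trilinear_on A (*) C" for C
    by (simp add: sum_lessThan_double X_def Y_def d'_def sum.distrib[symmetric] del: w.scale_minus_left
        cong: sum.cong)
      (intro sum.cong refl; simp add: yang_baxter_summand_scale[OF A C] c del: w.scale_minus_left;
        simp add: algebra_simps)
  then show ?thesis
    unfolding super_HJYBE_solution_presentation[OF A p] by simp
qed

section \<open>Contraction with a dual basis\<close>

locale dual_tensor = dualizable_module J M
  for J :: "('k::field, 'j::ab_group_add) hom_superalgebra"
    and M :: "('k, 'j, 'v::ab_group_add) hom_module" +
  fixes T :: "'v \<Rightarrow> 'j" and e :: "nat \<Rightarrow> 'v" and par :: "nat \<Rightarrow> bit" and N :: nat
  assumes T: "even_linear M J T"
    and T_twist: "\<And>w. w \<in> carrier M \<Longrightarrow> T (twist M w) = twist J (T w)"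
    and e_grd: "\<And>k. k < N \<Longrightarrow> e k \<in> grd M (par k)"
    and e_inj: "inj_on e {..<N}"
    and e_indep: "\<not> m.dependent (e ` {..<N})"
    and e_span: "m.span (e ` {..<N}) = carrier M"
begin

abbreviation dual_e where "dual_e k \<equiv> dual_vec M (e ` {..<N}) (e k)"

abbreviation twisted_dual_e where "twisted_dual_e k \<equiv> twist D (dual_e k)"

lemma e_carrier: "k < N \<Longrightarrow> e k \<in> carrier M"
  using e_grd carrier_M(1) by blast

lemma T_carrier: "w \<in> carrier M \<Longrightarrow> T w \<in> carrier J"
  using even_linear_carrier[OF superspace_J T superspace_M] .

lemma T_grd: "w \<in> grd M a \<Longrightarrow> T w \<in> grd J a"
  using T by (simp add: even_linear_def)

lemma T_linear: "linear_on (carrier M) (scl M) (scl J) T"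
  using T by (simp add: even_linear_def)

lemma dual_e_e: "i < N \<Longrightarrow> k < N \<Longrightarrow> dual_e i (e k) = (if i = k then 1 else 0)"
  using m.representation_basis[OF e_indep, of "e k"] inj_onD[OF e_inj, of k i]
  by (auto simp: dual_vec_def)

lemma dual_e_linear: "linear_on (carrier M) (scl M) (*) (dual_e k)"
  unfolding dual_vec_def by (rule linear_on_representation[OF m.vector_space_axioms e_indep e_span])

lemma dual_e_carrier: "dual_e k \<in> carrier D"
  using dual_e_linear e_span by (auto simp: carrier_dual dual_vec_def m.representation_def)

text \<open>
  The form \<open>e\<^sub>k\<^sup>*\<close> agrees on the basis, hence everywhere, with its composition with the projection to
  the parity of \<open>e\<^sub>k\<close>, because that projection fixes or kills each basis vector.
\<close>

lemma dual_e_parity: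
  assumes k: "k < N" and w: "w \<in> grd M a" and a: "par k \<noteq> a"
  shows "dual_e k w = 0"
proof -
  have "linear_on (carrier M) (scl M) (*) (\<lambda>w. dual_e k (hpart (grd M) (par k) w))"
    using dual_e_linear[of k] linear_on_hpart[OF superspace_M, of "par k"]
      carrier_M(1)[OF hpart_carrier(1)[OF superspace_M]]
    by (simp add: linear_on_def)
  moreover have "dual_e k b = dual_e k (hpart (grd M) (par k) b)" if b: "b \<in> e ` {..<N}" for b
  proof -
    obtain i where "i < N" "b = e i" using b by blast
    then show ?thesis
      using hpart_homogeneous[OF superspace_M e_grd] dual_e_e[OF k] k
        linear_on_zero[OF dual_e_linear subspace_carrier[OF superspace_M] m.vector_space_axioms]
      by auto
  qed
  ultimately have "dual_e k w = dual_e k (hpart (grd M) (par k) w)"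
    using linear_on_eq_span[OF dual_e_linear _ e_span m.vector_space_axioms vector_space_mult] carrier_M(1)[OF w] by blast
  then show ?thesis
    using hpart_homogeneous[OF superspace_M w] a
      linear_on_zero[OF dual_e_linear subspace_carrier[OF superspace_M] m.vector_space_axioms]
    by simp
qed

lemma dual_e_grd: "k < N \<Longrightarrow> dual_e k \<in> grd D (par k)"
  using dual_e_carrier[of k, unfolded carrier_dual] dual_e_parity[of k _ "par k + 1"]
  unfolding dual_simps(2) dual_grd_def by auto

lemma twisted_dual_e_grd: "k < N \<Longrightarrow> twisted_dual_e k \<in> grd D (par k)"
  using graded_hom_module_dual dual_e_grd by (simp add: graded_hom_module_def even_linear_def)

lemma twisted_dual_e_carrier: "k < N \<Longrightarrow> twisted_dual_e k \<in> carrier D"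
  using twisted_dual_e_grd grd_subset_carrier[OF superspace_dual] by blast

lemma expand_e:
  assumes "w \<in> carrier M"
  shows "(\<Sum>k<N. scl M (dual_e k w) (e k)) = w"
proof -
  have "(\<Sum>b\<in>e ` {..<N}. scl M (m.representation (e ` {..<N}) w b) b) = w"
    using m.sum_representation_eq[OF e_indep] assms e_span by simp
  then show ?thesis by (simp add: sum.reindex[OF e_inj] dual_vec_def)
qed

lemma linear_expand:
  assumes "linear_on (carrier M) (scl M) t f" "vector_space t" "w \<in> carrier M"
  shows "f w = (\<Sum>k<N. t (dual_e k w) (f (e k)))"
proof -
  have "f (\<Sum>k<N. scl M (dual_e k w) (e k)) = (\<Sum>k<N. t (dual_e k w) (f (e k)))"
    using e_carrier
    by (intro linear_on_sum[OF assms(1) subspace_carrier[OF superspace_M] m.vector_space_axioms assms(2)]) simp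
  then show ?thesis by (simp add: expand_e assms(3))
qed

text \<open>
  The forms \<open>g\<^sub>k\<close> are dual to the basis \<open>\<beta> e\<^sub>k\<close>.
\<close>

lemma expand_twisted_dual_e:
  assumes \<xi>: "\<xi> \<in> carrier D"
  shows "\<xi> = (\<Sum>k<N. fun_scale (\<xi> (twist M (e k))) (twisted_dual_e k))"
proof
  fix w
  show "\<xi> w = (\<Sum>k<N. fun_scale (\<xi> (twist M (e k))) (twisted_dual_e k)) w"
  proof (cases "w \<in> carrier M")
    case True
    have "linear_on (carrier M) (scl M) (*) (\<lambda>w. \<xi> (twist M w))"
      using \<xi> even_twist(1) twist_carrier(1) by (simp add: carrier_dual even_linear_def linear_on_def)
    from linear_expand[OF this vector_space_mult inv_twist(3)[OF True]]
    show ?thesis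
      using True by (simp add: sum_fun_apply fun_scale_def inv_twist dual_simps(3) dual_map_def mult.commute)
  next
    case False
    then show ?thesis
      using \<xi> by (simp add: carrier_dual sum_fun_apply fun_scale_def dual_simps(3) dual_map_def)
  qed
qed

text \<open>
  The invariance of the canonical tensor: \<open>\<Sum>\<^sub>i e\<^sub>i \<otimes> (e\<^sub>i\<^sup>* \<circ> \<phi>) = \<Sum>\<^sub>k \<phi>(e\<^sub>k) \<otimes> e\<^sub>k\<^sup>*\<close> for a map \<open>\<phi>\<close> of parity \<open>d\<close>,
  with \<open>S\<close> applied to the first factors and the second factors twisted, and evaluated at a bilinear
  form \<open>L\<close>. The weights \<open>\<sigma>\<close> carry the signs of the Koszul rule; they can be moved across since
  \<open>e\<^sub>i\<^sup>*(\<phi>(e\<^sub>k))\<close> is nonzero only if the parity of \<open>e\<^sub>i\<close> is that of \<open>e\<^sub>k\<close> plus \<open>d\<close>.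
\<close>

lemma contraction:
  fixes \<sigma> :: "bit \<Rightarrow> 'k"
  assumes L: "bilinear_on J D (*) L"
    and S: "linear_on (carrier M) (scl M) (scl J) S" "\<And>w. w \<in> carrier M \<Longrightarrow> S w \<in> carrier J"
    and \<phi>: "\<And>k. k < N \<Longrightarrow> \<phi> k \<in> grd M (par k + d)"
    and \<eta>: "\<And>i. i < N \<Longrightarrow> \<eta> i \<in> carrier D"
      "\<And>i k. i < N \<Longrightarrow> k < N \<Longrightarrow> \<eta> i (twist M (e k)) = dual_e i (\<phi> k)"
  shows "(\<Sum>i<N. \<sigma> (par i) * L (S (e i)) (\<eta> i)) = (\<Sum>k<N. \<sigma> (par k + d) * L (S (\<phi> k)) (twisted_dual_e k))"
proof -
  have SJ: "S (e i) \<in> carrier J" if "i < N" for i using S(2) e_carrier that by blast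
  have 1: "L (S (e i)) (\<eta> i) = (\<Sum>k<N. dual_e i (\<phi> k) * L (S (e i)) (twisted_dual_e k))" if i: "i < N" for i
  proof -
    have l: "linear_on (carrier D) fun_scale (*) (L (S (e i)))"
      using L SJ[OF i] dual_simps(1) unfolding bilinear_on_def by metis
    have "L (S (e i)) (\<eta> i) = L (S (e i)) (\<Sum>k<N. fun_scale (\<eta> i (twist M (e k))) (twisted_dual_e k))"
      using expand_twisted_dual_e[OF \<eta>(1)[OF i]] by simp
    also have "\<dots> = (\<Sum>k<N. \<eta> i (twist M (e k)) * L (S (e i)) (twisted_dual_e k))"
      using subspace_carrier[OF superspace_dual] twisted_dual_e_carrier
      by (intro linear_on_sum[OF l _ vector_space_fun_scale vector_space_mult]) (auto simp only: dual_simps(1) lessThan_iff)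
    finally show ?thesis using \<eta>(2) i by simp
  qed
  have "(\<Sum>i<N. \<sigma> (par i) * L (S (e i)) (\<eta> i)) =
      (\<Sum>i<N. \<Sum>k<N. \<sigma> (par i) * (dual_e i (\<phi> k) * L (S (e i)) (twisted_dual_e k)))"
    by (simp add: 1 sum_distrib_left)
  also have "\<dots> = (\<Sum>k<N. \<Sum>i<N. \<sigma> (par i) * (dual_e i (\<phi> k) * L (S (e i)) (twisted_dual_e k)))"
    by (rule sum.swap)
  also have "\<dots> = (\<Sum>k<N. \<Sum>i<N. \<sigma> (par k + d) * (dual_e i (\<phi> k) * L (S (e i)) (twisted_dual_e k)))"
  proof (intro sum.cong refl)
    fix k i assume "k \<in> {..<N}" "i \<in> {..<N}"
    then show "\<sigma> (par i) * (dual_e i (\<phi> k) * L (S (e i)) (twisted_dual_e k)) =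
        \<sigma> (par k + d) * (dual_e i (\<phi> k) * L (S (e i)) (twisted_dual_e k))"
      using dual_e_parity[of i "\<phi> k" "par k + d"] \<phi>[of k] by (cases "par i = par k + d") auto
  qed
  also have "\<dots> = (\<Sum>k<N. \<sigma> (par k + d) * L (S (\<phi> k)) (twisted_dual_e k))"
  proof (rule sum.cong[OF refl])
    fix k assume "k \<in> {..<N}"
    then have k: "k < N" by simp
    have "linear_on (carrier J) (scl J) (*) (\<lambda>x. L x (twisted_dual_e k))"
      using L twisted_dual_e_carrier[OF k] unfolding bilinear_on_def by blast
    then have "linear_on (carrier M) (scl M) (*) (\<lambda>w. L (S w) (twisted_dual_e k))"
      using S by (simp add: linear_on_def)
    from linear_expand[OF this vector_space_mult carrier_M(1)[OF \<phi>[OF k]]]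
    show "(\<Sum>i<N. \<sigma> (par k + d) * (dual_e i (\<phi> k) * L (S (e i)) (twisted_dual_e k))) =
        \<sigma> (par k + d) * L (S (\<phi> k)) (twisted_dual_e k)"
      by (simp add: sum_distrib_left)
  qed
  finally show ?thesis .
qed

abbreviation A where "A \<equiv> semidirect J D"

lemma A: "graded_hom_algebra A" and superspace_A: "superspace A"
  using graded_hom_algebra_semidirect[OF J graded_hom_module_dual] by (simp_all add: graded_hom_algebra_def)

lemmas A_simps = semidirect_simps[OF J graded_hom_module_dual]

abbreviation X where "X k \<equiv> (T (e k), 0 :: 'v \<Rightarrow> 'k)"
abbreviation Y where "Y k \<equiv> (0 :: 'j, dual_e k)"

lemma zero_grd: "0 \<in> grd J a" "0 \<in> grd D a"
proof -
  interpret f: vector_space "fun_scale :: 'k \<Rightarrow> ('v \<Rightarrow> 'k) \<Rightarrow> _" by (rule vector_space_fun_scale)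
  show "0 \<in> grd J a" using superspace_J j.subspace_0 by (simp add: superspace_def)
  show "0 \<in> grd D a" using superspace_dual f.subspace_0 by (simp add: superspace_def dual_simps(1))
qed

lemma zero_carrier: "0 \<in> carrier J" "0 \<in> carrier D"
  using zero_grd grd_subset_carrier superspace_J superspace_dual by blast+

lemma XY_grd: "k < N \<Longrightarrow> X k \<in> grd A (par k)" "k < N \<Longrightarrow> Y k \<in> grd A (par k)"
  using e_grd T_grd dual_e_grd zero_grd by (simp_all add: A_simps)

definition skew_tensor where "skew_tensor = (\<Sum>i<N. tensor2 A (X i) (Y i))
  - (\<Sum>i<N. fun_scale (ksign (par i)) (tensor2 A (Y i) (X i)))"

lemma skew_tensor_swap:
  "skew_tensor = (\<Sum>i<N. tensor2 A (X i) (Y i)) - tensor_swap A (\<Sum>i<N. tensor2 A (X i) (Y i))"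
  unfolding skew_tensor_def by (subst tensor_swap_skew(1)[OF superspace_A]) (use XY_grd in auto)

lemma skew_tensor_skew: "super_skew_symmetric A skew_tensor"
proof -
  have "skew_tensor \<in> tensor_square A"
    unfolding skew_tensor_def
    by (rule tensor_square_presentation[OF superspace_A skew_presentation[OF superspace_A]])
      (use XY_grd in auto)
  moreover have "tensor_swap A skew_tensor = - skew_tensor"
  proof -
    have "tensor_swap A (a - b) = tensor_swap A a - tensor_swap A b" for a b
      by (simp add: tensor_swap_def tensor_lift_def fun_eq_iff)
    then show ?thesis
      using tensor_swap_skew[OF superspace_A, of "{..<N}" X par Y] XY_grd
      unfolding skew_tensor_def by simp
  qed
  ultimately show ?thesis by (simp add: super_skew_symmetric_def)
qed

lemma fun_scale_zero: "fun_scale c 0 = 0" "fun_scale 0 \<xi> = 0"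
  by (simp_all add: fun_scale_def fun_eq_iff)

lemma linear_on_comp:
  assumes "linear_on S s t f" "\<And>x. x \<in> S \<Longrightarrow> f x \<in> S'" "linear_on S' t u h"
  shows "linear_on S s u (\<lambda>x. h (f x))"
  using assms by (simp add: linear_on_def)

lemma embed_carrier:
  "x \<in> carrier J \<Longrightarrow> (x, 0) \<in> carrier A" "\<xi> \<in> carrier D \<Longrightarrow> (0, \<xi>) \<in> carrier A"
  using zero_carrier by (simp_all only: A_simps mem_Sigma_iff)

lemma linear_embed:
  "linear_on (carrier J) (scl J) (scl A) (\<lambda>x. (x, 0))"
  "linear_on (carrier D) (scl D) (scl A) (\<lambda>\<xi>. (0, \<xi>))"
  by (simp_all add: linear_on_def A_simps dual_simps(1) fun_scale_zero)

lemma bilinear_restrict: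
  assumes "bilinear_on A A (*) B"
  shows "bilinear_on J D (*) (\<lambda>x \<xi>. B (x, 0) (0, \<xi>))" "bilinear_on J D (*) (\<lambda>x \<xi>. B (0, \<xi>) (x, 0))"
proof -
  have B: "linear_on (carrier A) (scl A) (*) (\<lambda>q. B p q)" "linear_on (carrier A) (scl A) (*) (\<lambda>q. B q p)"
    if "p \<in> carrier A" for p
    using assms that unfolding bilinear_on_def by blast+
  show "bilinear_on J D (*) (\<lambda>x \<xi>. B (x, 0) (0, \<xi>))" "bilinear_on J D (*) (\<lambda>x \<xi>. B (0, \<xi>) (x, 0))"
    unfolding bilinear_on_def
    by (intro conjI ballI;
        rule linear_on_comp[OF linear_embed(1) embed_carrier(1) B(1)]
          linear_on_comp[OF linear_embed(1) embed_carrier(1) B(2)]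
          linear_on_comp[OF linear_embed(2) embed_carrier(2) B(1)]
          linear_on_comp[OF linear_embed(2) embed_carrier(2) B(2)];
        simp only: embed_carrier)+
qed

lemma twist_zero: "twist J 0 = 0" "twist D 0 = 0"
  using linear_on_zero[OF _ subspace_carrier[OF superspace_J] j.vector_space_axioms] even_twist(2)
  by (auto simp: even_linear_def dual_simps(3) dual_map_def fun_eq_iff)

text \<open>
  Contraction with \<open>\<phi> = \<beta>\<close> and \<open>S = T\<close>, applied to \<open>T\<close> and to \<open>\<sigma>(T)\<close>.
\<close>

lemma skew_tensor_twist: "tensor_twist A skew_tensor = skew_tensor"
proof -
  have tw: "tensor_twist A (tensor2 A (X i) (Y i)) = tensor2 A (twist J (T (e i)), 0) (0, twisted_dual_e i)"
    "tensor_twist A (tensor2 A (Y i) (X i)) = tensor2 A (0, twisted_dual_e i) (twist J (T (e i)), 0)" if "i < N" for i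
    using tensor_twist_tensor2[OF superspace_A _ grd_subset_carrier[OF superspace_A XY_grd(1)[OF that]]
        grd_subset_carrier[OF superspace_A XY_grd(2)[OF that]]]
      tensor_twist_tensor2[OF superspace_A _ grd_subset_carrier[OF superspace_A XY_grd(2)[OF that]]
        grd_subset_carrier[OF superspace_A XY_grd(1)[OF that]]] A
    by (simp_all add: graded_hom_algebra_def A_simps twist_zero)
  have lin: "tensor_twist A (\<Sum>i\<in>I. fun_scale (c i) (f i)) = (\<Sum>i\<in>I. fun_scale (c i) (tensor_twist A (f i)))"
    "tensor_twist A (a - b) = tensor_twist A a - tensor_twist A b"
    for I :: "nat set" and c f a b
    by (simp_all add: tensor_twist_def tensor_lift_def sum_fun_apply fun_scale_def fun_eq_iff)
  have lin1: "tensor_twist A (\<Sum>i\<in>I. f i) = (\<Sum>i\<in>I. tensor_twist A (f i))" for I :: "nat set" and f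
    by (simp add: tensor_twist_def tensor_lift_def sum_fun_apply fun_eq_iff)
  have c: "(\<Sum>i<N. \<sigma> (par i) * L (T (e i)) (dual_e i)) = (\<Sum>k<N. \<sigma> (par k) * L (twist J (T (e k))) (twisted_dual_e k))"
    if L: "bilinear_on J D (*) L" for L and \<sigma> :: "bit \<Rightarrow> 'k"
  proof -
    have "(\<Sum>i<N. \<sigma> (par i) * L (T (e i)) (dual_e i)) = (\<Sum>k<N. \<sigma> (par k + 0) * L (T (twist M (e k))) (twisted_dual_e k))"
    proof (rule contraction[OF L T_linear T_carrier])
      show "twist M (e k) \<in> grd M (par k + 0)" if "k < N" for k
        using e_grd[OF that] even_twist(1) unfolding even_linear_def add_0_right by blast
    qed (simp_all only: dual_e_carrier)
    then show ?thesis unfolding add_0_right by (simp add: T_twist e_carrier)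
  qed
  show ?thesis
  proof
    fix B
    show "tensor_twist A skew_tensor B = skew_tensor B"
    proof (cases "bilinear_on A A (*) B")
      case True
      then show ?thesis
        using c[OF bilinear_restrict(1)[OF True], of "\<lambda>_. 1"] c[OF bilinear_restrict(2)[OF True], of ksign]
        by (simp add: skew_tensor_def lin lin1 tw sum_fun_apply) (simp add: tensor2_def fun_scale_def)
    next
      case False
      then show ?thesis
        by (simp add: skew_tensor_def lin lin1 tw sum_fun_apply) (simp add: tensor2_def fun_scale_def)
    qed
  qed
qed

text \<open>
  The \<open>V\<^sup>*\<close>-component of the product \<open>e\<^sub>i\<^sup>* \<cdot> T(e\<^sub>j)\<close> in the semi-direct product.
\<close>

definition dual_prod where "dual_prod i j = fun_scale (ksign (par i * par j)) (act D (T (e j)) (dual_e i))"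

definition T_act where "T_act i j = T (act M (T (e i)) (e j))"

text \<open>
  The value \<open>O(e\<^sub>i, e\<^sub>j)\<close> of the defect of \<open>T\<close> from being an \<open>\<O>\<close>-operator.
\<close>

definition defect where "defect i j =
  prd J (T (e i)) (T (e j)) - (T_act i j + scl J (ksign (par i * par j)) (T_act j i))"

lemma act_D_zero: "x \<in> carrier J \<Longrightarrow> act D x 0 = 0" "\<xi> \<in> carrier D \<Longrightarrow> act D 0 \<xi> = 0"
  using bilinear_on_zero[OF _ superspace_J superspace_dual] graded_hom_module_dual
  by (auto simp: graded_hom_module_def)

lemma prd_J_zero: "x \<in> carrier J \<Longrightarrow> prd J x 0 = 0" "x \<in> carrier J \<Longrightarrow> prd J 0 x = 0"
  using bilinear_on_zero[OF _ superspace_J superspace_J] J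
  by (auto simp: graded_hom_algebra_def)

lemma XY_prd:
  assumes i: "i < N" and j: "j < N"
  shows "prd A (X i) (X j) = (prd J (T (e i)) (T (e j)), 0)"
    "prd A (Y i) (X j) = (0, dual_prod i j)"
    "prd A (X i) (Y j) = (0, fun_scale (ksign (par i * par j)) (dual_prod j i))"
    "prd A (Y i) (Y j) = (0, 0)"
proof -
  have c: "T (e i) \<in> carrier J" "T (e j) \<in> carrier J" using i j T_carrier e_carrier by auto
  have ss: "fun_scale (ksign a) (fun_scale (ksign a) \<xi>) = \<xi>" for a :: bit and \<xi> :: "'v \<Rightarrow> 'k"
    by (simp add: fun_scale_def ksign_def fun_eq_iff)
  note p = prd_semidirect[OF J graded_hom_module_dual, of _ "par i" _ _ "par j"]
  note z = act_D_zero(1)[OF c(1)] act_D_zero(1)[OF c(2)] act_D_zero(1)[OF zero_carrier(1)]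
     act_D_zero(2)[OF dual_e_carrier] prd_J_zero(1)[OF c(1)] prd_J_zero(2)[OF c(2)]
     prd_J_zero(2)[OF c(1)] prd_J_zero(1)[OF c(2)] prd_J_zero(1)[OF zero_carrier(1)] fun_scale_zero
  note gr = T_grd[OF e_grd] dual_e_grd zero_grd i j
  show "prd A (X i) (X j) = (prd J (T (e i)) (T (e j)), 0)"
    "prd A (Y i) (X j) = (0, dual_prod i j)"
    "prd A (X i) (Y j) = (0, fun_scale (ksign (par i * par j)) (dual_prod j i))"
    "prd A (Y i) (Y j) = (0, 0)"
    by (simp_all only: p gr z dual_simps(1) add_0_left add_0_right dual_prod_def ss mult.commute[of "par j"])
qed

lemma dual_prod_carrier: "i < N \<Longrightarrow> j < N \<Longrightarrow> dual_prod i j \<in> carrier D"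
  using graded_hom_algebra_carrier(2)[OF A, of "Y i" "X j"] grd_subset_carrier[OF superspace_A XY_grd(1)]
    grd_subset_carrier[OF superspace_A XY_grd(2)]
  by (simp only: XY_prd A_simps mem_Sigma_iff)

lemma dual_prod_eval: "i < N \<Longrightarrow> j < N \<Longrightarrow> k < N \<Longrightarrow>
   dual_prod i j (twist M (e k)) = dual_e i (inv_twist (act M (T (e j)) (e k)))"
  using act_dual_twist[OF T_grd[OF e_grd] dual_e_grd e_carrier, of j i k]
  by (simp add: dual_prod_def fun_scale_def ksign_def split: if_splits)

text \<open>
  Contraction with \<open>\<phi> = \<beta>\<^sup>-\<^sup>1 \<pi>(T(e\<^sub>j))\<close> and \<open>S = \<alpha> T\<close>; the twists cancel because
  \<open>\<alpha> T \<beta>\<^sup>-\<^sup>1 = T\<close>.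
\<close>

lemma contraction_dual_prod:
  fixes \<sigma> :: "bit \<Rightarrow> 'k"
  assumes L: "bilinear_on J D (*) L" and j: "j < N"
  shows "(\<Sum>i<N. \<sigma> (par i) * L (twist J (T (e i))) (dual_prod i j)) =
    (\<Sum>k<N. \<sigma> (par k + par j) * L (T_act j k) (twisted_dual_e k))"
proof -
  let ?\<phi> = "\<lambda>k. inv_twist (act M (T (e j)) (e k))"
  have a: "act M (T (e j)) (e k) \<in> grd M (par k + par j)" if "k < N" for k
    using M T_grd[OF e_grd[OF j]] e_grd[OF that] unfolding graded_hom_module_def
    by (metis add.commute)
  then have "(\<Sum>i<N. \<sigma> (par i) * L (twist J (T (e i))) (dual_prod i j)) =
    (\<Sum>k<N. \<sigma> (par k + par j) * L (twist J (T (?\<phi> k))) (twisted_dual_e k))"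
  proof (intro contraction[OF L])
    show "linear_on (carrier M) (scl M) (scl J) (\<lambda>w. twist J (T w))"
      using T_linear even_twist(2) T_carrier by (simp add: linear_on_def even_linear_def)
  qed (use even_linear_inv_twist dual_prod_carrier dual_prod_eval j twist_carrier(2) T_carrier in
      \<open>auto simp: even_linear_def\<close>)
  also have "\<dots> = (\<Sum>k<N. \<sigma> (par k + par j) * L (T_act j k) (twisted_dual_e k))"
  proof (rule sum.cong[OF refl])
    fix k assume "k \<in> {..<N}"
    then have "act M (T (e j)) (e k) \<in> carrier M" using a carrier_M(1) by blast
    then have "twist J (T (?\<phi> k)) = T_act j k"
      using T_twist inv_twist unfolding T_act_def by metis
    then show "\<sigma> (par k + par j) * L (twist J (T (?\<phi> k))) (twisted_dual_e k) = \<sigma> (par k + par j) * L (T_act j k) (twisted_dual_e k)"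
      by simp
  qed
  finally show ?thesis .
qed

section \<open>The Yang-Baxter expression of the skew tensor\<close>

lemma T_act_carrier: "i < N \<Longrightarrow> j < N \<Longrightarrow> T_act i j \<in> carrier J"
  unfolding T_act_def using T_carrier act_simps(1)[OF T_carrier] e_carrier by simp

lemma prd_T_carrier: "i < N \<Longrightarrow> j < N \<Longrightarrow> prd J (T (e i)) (T (e j)) \<in> carrier J"
  using graded_hom_algebra_carrier(2)[OF J] T_carrier e_carrier by simp

lemma carrier_J_diff: "x \<in> carrier J \<Longrightarrow> y \<in> carrier J \<Longrightarrow> x - y \<in> carrier J"
  using j.subspace_diff[OF subspace_carrier[OF superspace_J]] .

lemma defect_carrier: "i < N \<Longrightarrow> j < N \<Longrightarrow> defect i j \<in> carrier J"
  unfolding defect_def by (intro carrier_J_diff carrier_J(3,4) T_act_carrier prd_T_carrier)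

text \<open>
  Among the twelve products of one factor \<open>T(e\<^sub>i)\<close> or \<open>e\<^sub>i\<^sup>*\<close> with another in the Yang-Baxter
  expression, three are products in \<open>\<J>\<close>, three vanish as products of two dual vectors, and the
  remaining six are removed by contraction.
\<close>

lemma yang_baxter_contracted:
  assumes C: "trilinear_on A (*) C"
  shows "(\<Sum>i<N. \<Sum>j<N.
       yang_baxter_summand A C (par i) (X i) (Y i) (par j) (X j) (Y j)
       - ksign (par j) * yang_baxter_summand A C (par i) (X i) (Y i) (par j) (Y j) (X j)
       - ksign (par i) * yang_baxter_summand A C (par i) (Y i) (X i) (par j) (X j) (Y j)
       + ksign (par i) * ksign (par j) * yang_baxter_summand A C (par i) (Y i) (X i) (par j) (Y j) (X j))
   = (\<Sum>i<N. \<Sum>j<N.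
       ksign (par i * par j) * C (defect i j, 0) (0, twisted_dual_e i) (0, twisted_dual_e j)
       + ksign (par i) * C (0, twisted_dual_e i) (defect i j, 0) (0, twisted_dual_e j)
       + ksign (par i) * ksign (par j) * ksign (par i * par j) * C (0, twisted_dual_e i) (0, twisted_dual_e j) (defect i j, 0))"
    (is "_ = ?rhs")
proof -
  define s :: "nat \<Rightarrow> nat \<Rightarrow> 'k" where "s i j = ksign (par i * par j)" for i j
  define t :: "nat \<Rightarrow> 'k" where "t i = ksign (par i)" for i
  \<comment> \<open>The elements of the semi-direct product that occur in the three slots.\<close>
  define a where "a i = (twist J (T (e i)), 0 :: 'v \<Rightarrow> 'k)" for i
  define G where "G i = (0 :: 'j, twisted_dual_e i)" for i
  define H where "H i j = (0 :: 'j, dual_prod i j)" for i j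
  define P where "P i j = (prd J (T (e i)) (T (e j)), 0 :: 'v \<Rightarrow> 'k)" for i j
  define Q where "Q i j = (T_act i j, 0 :: 'v \<Rightarrow> 'k)" for i j
  have ca: "a i \<in> carrier A" "G i \<in> carrier A" if "i < N" for i
    unfolding a_def G_def using that by (simp_all only: embed_carrier twisted_dual_e_carrier twist_carrier(2) T_carrier e_carrier)
  have cb: "H i j \<in> carrier A" "P i j \<in> carrier A" "Q i j \<in> carrier A" if "i < N" "j < N" for i j
    unfolding H_def P_def Q_def using that
    by (simp_all only: embed_carrier dual_prod_carrier prd_T_carrier T_act_carrier)
  have tri: "bilinear_on A A (*) (\<lambda>x y. C x y z)" "bilinear_on A A (*) (\<lambda>x y. C x z y)"
    "bilinear_on A A (*) (\<lambda>x y. C z x y)" if "z \<in> carrier A" for z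
    using C that unfolding trilinear_on_def bilinear_on_def by blast+
  have C0: "C x y (0, 0) = 0" "C x (0, 0) y = 0" "C (0, 0) x y = 0"
    if "x \<in> carrier A" "y \<in> carrier A" for x y
    using bilinear_on_zero[OF tri(3)[OF that(1)] superspace_A superspace_A]
      bilinear_on_zero[OF tri(1)[OF that(2)] superspace_A superspace_A] that
    by (simp_all flip: zero_prod_def)
  have Cs: "C (scl A k x) y z = k * C x y z" "C x (scl A k y) z = k * C x y z" "C x y (scl A k z) = k * C x y z"
    if "x \<in> carrier A" "y \<in> carrier A" "z \<in> carrier A" for x y z k
    using C that by (simp_all add: trilinear_on_def linear_on_def)
  have sq: "s i j * s i j = 1" for i j by (simp add: s_def ksign_square)
  have ss: "s i j * (s i j * x) = x" for i j x using sq by (simp flip: mult.assoc)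
  have twX: "twist A (X i) = a i" "twist A (Y i) = G i" if "i < N" for i
    by (simp_all only: A_simps a_def G_def twist_zero)
  have pr: "prd A (X i) (X j) = P i j" "prd A (Y i) (X j) = H i j"
    "prd A (X i) (Y j) = scl A (s i j) (H j i)" "prd A (Y i) (Y j) = (0, 0)" if "i < N" "j < N" for i j
    by (simp_all only: XY_prd[OF that] P_def H_def s_def A_simps dual_simps(1) j.scale_zero_right)
  have sw: "ksign (par j * par i) = s i j" for i j by (simp add: s_def mult.commute)
  note simps = yang_baxter_summand_def twX pr sw ca cb C0 Cs
  have dec: "yang_baxter_summand A C (par i) (X i) (Y i) (par j) (X j) (Y j)
       - t j * yang_baxter_summand A C (par i) (X i) (Y i) (par j) (Y j) (X j)
       - t i * yang_baxter_summand A C (par i) (Y i) (X i) (par j) (X j) (Y j)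
       + t i * t j * yang_baxter_summand A C (par i) (Y i) (X i) (par j) (Y j) (X j)
     = (s i j * C (P i j) (G i) (G j) + t i * C (G i) (P i j) (G j) + t i * t j * s i j * C (G i) (G j) (P i j))
       - C (a i) (H i j) (G j) - t j * s i j * C (a i) (G j) (H i j)
       - t i * s i j * C (H i j) (a i) (G j)
       - t j * C (H j i) (G i) (a j)
       - t i * C (G i) (a j) (H j i) - t i * t j * s i j * C (G i) (H j i) (a j)" if "i < N" "j < N" for i j
  proof -
    have y1: "yang_baxter_summand A C (par i) (X i) (Y i) (par j) (X j) (Y j) = s i j * C (P i j) (G i) (G j) - C (a i) (H i j) (G j)"
      using that by (simp only: simps) simp
    have y2: "yang_baxter_summand A C (par i) (X i) (Y i) (par j) (Y j) (X j) = C (H j i) (G i) (a j) + s i j * C (a i) (G j) (H i j)"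
      using that by (simp only: simps ss) simp
    have y3: "yang_baxter_summand A C (par i) (Y i) (X i) (par j) (X j) (Y j) = s i j * C (H i j) (a i) (G j) - C (G i) (P i j) (G j) + C (G i) (a j) (H j i)"
      using that by (simp only: simps ss)
    have y4: "yang_baxter_summand A C (par i) (Y i) (X i) (par j) (Y j) (X j) = - s i j * C (G i) (H j i) (a j) + s i j * C (G i) (G j) (P i j)"
      using that by (simp only: simps) simp
    show ?thesis
      unfolding y1 y2 y3 y4 by (simp add: algebra_simps)
  qed
  have con: "(\<Sum>i<N. \<sigma> (par i) * B (a i) (H i j)) = (\<Sum>k<N. \<sigma> (par k + par j) * B (Q j k) (G k))"
    "(\<Sum>i<N. \<sigma> (par i) * B (H i j) (a i)) = (\<Sum>k<N. \<sigma> (par k + par j) * B (G k) (Q j k))"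
    if "bilinear_on A A (*) B" "j < N" for B j and \<sigma> :: "bit \<Rightarrow> 'k"
    using contraction_dual_prod[OF bilinear_restrict(1)[OF that(1)] that(2), of \<sigma>]
      contraction_dual_prod[OF bilinear_restrict(2)[OF that(1)] that(2), of \<sigma>]
    by (simp_all only: a_def H_def Q_def G_def)
  \<comment> \<open>The weights that occur are functions of the parity of the contracted index, which contraction
    replaces by a sum of two parities; the signs then simplify since parities are idempotent.\<close>
  have sg: "ksign y * ksign ((x + y) * y) = (ksign (x * y) :: 'k)"
    "ksign (x + y) * ksign ((x + y) * y) = ksign x * (ksign (x * y) :: 'k)"
    "ksign (x + y) * ksign (y * (x + y)) = ksign x * (ksign (y * x) :: 'k)" for x y
    by (cases x; cases y; simp add: ksign_def)+
  \<comment> \<open>The six contractions. In \<open>c2\<close> and \<open>c5\<close> the names of the two indices are exchanged afterwards,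
    so that the free dual factors appear in the order \<open>G i\<close>, \<open>G j\<close>.\<close>
  have c1: "(\<Sum>i<N. \<Sum>j<N. C (a i) (H i j) (G j)) = (\<Sum>i<N. \<Sum>j<N. C (Q j i) (G i) (G j))"
  proof -
    have "(\<Sum>j<N. \<Sum>i<N. C (a i) (H i j) (G j)) = (\<Sum>j<N. \<Sum>k<N. C (Q j k) (G k) (G j))"
      using con(1)[OF tri(1)[OF ca(2)], where \<sigma> = "\<lambda>_. 1"] by simp
    then show ?thesis by (subst (1 2) sum.swap)
  qed
  have c2: "(\<Sum>i<N. \<Sum>j<N. t j * s i j * C (a i) (G j) (H i j)) = (\<Sum>i<N. \<Sum>j<N. s i j * C (Q i j) (G i) (G j))"
  proof -
    have "(\<Sum>i<N. t j * s i j * C (a i) (G j) (H i j)) = (\<Sum>k<N. s k j * C (Q j k) (G j) (G k))"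
      if "j < N" for j
      using con(1)[OF tri(2)[OF ca(2)[OF that]] that, where \<sigma> = "\<lambda>b. t j * ksign (b * par j)"]
      by (simp only: t_def s_def sg)
    moreover have "s k j = s j k" for j k by (simp add: s_def mult.commute)
    ultimately show ?thesis by (subst sum.swap) simp
  qed
  have c3: "(\<Sum>i<N. \<Sum>j<N. t i * s i j * C (H i j) (a i) (G j)) = (\<Sum>i<N. \<Sum>j<N. t i * s i j * C (G i) (Q j i) (G j))"
  proof -
    have "(\<Sum>i<N. t i * s i j * C (H i j) (a i) (G j)) = (\<Sum>k<N. t k * s k j * C (G k) (Q j k) (G j))"
      if "j < N" for j
      using con(2)[OF tri(1)[OF ca(2)[OF that]] that, where \<sigma> = "\<lambda>b. ksign b * ksign (b * par j)"]
      by (simp only: t_def s_def sg)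
    then have "(\<Sum>j<N. \<Sum>i<N. t i * s i j * C (H i j) (a i) (G j)) = (\<Sum>j<N. \<Sum>k<N. t k * s k j * C (G k) (Q j k) (G j))"
      by simp
    then show ?thesis by (subst (1 2) sum.swap)
  qed
  have c4: "(\<Sum>i<N. \<Sum>j<N. t i * C (G i) (a j) (H j i)) = (\<Sum>i<N. \<Sum>j<N. t i * C (G i) (Q i j) (G j))"
    using con(1)[OF tri(3)[OF ca(2)], where \<sigma> = "\<lambda>_. 1"]
    by (simp flip: sum_distrib_left)
  have c5: "(\<Sum>i<N. \<Sum>j<N. t j * C (H j i) (G i) (a j)) = (\<Sum>i<N. \<Sum>j<N. t i * t j * C (G i) (G j) (Q j i))"
  proof -
    have "(\<Sum>j<N. t j * C (H j i) (G i) (a j)) = (\<Sum>k<N. t k * t i * C (G k) (G i) (Q i k))" if "i < N" for i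
      using con(2)[OF tri(2)[OF ca(2)[OF that]] that, where \<sigma> = ksign]
      by (simp only: t_def ksign_mult)
    then have "(\<Sum>i<N. \<Sum>j<N. t j * C (H j i) (G i) (a j)) = (\<Sum>i<N. \<Sum>k<N. t k * t i * C (G k) (G i) (Q i k))"
      by simp
    then show ?thesis by (subst (2) sum.swap)
  qed
  have c6: "(\<Sum>i<N. \<Sum>j<N. t i * t j * s i j * C (G i) (H j i) (a j))
      = (\<Sum>i<N. \<Sum>j<N. t i * t j * s i j * C (G i) (G j) (Q i j))"
  proof -
    have "(\<Sum>j<N. t j * s i j * C (G i) (H j i) (a j)) = (\<Sum>j<N. t j * s i j * C (G i) (G j) (Q i j))"
      if "i < N" for i
      using con(2)[OF tri(3)[OF ca(2)[OF that]] that, where \<sigma> = "\<lambda>b. ksign b * ksign (par i * b)"]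
      by (simp only: t_def s_def sg)
    then show ?thesis by (simp add: mult.assoc flip: sum_distrib_left)
  qed
  interpret w: vector_space "scl A" using superspace_A by (simp add: superspace_def)
  have def: "C (defect i j, 0) y z = C (P i j) y z - C (Q i j) y z - s i j * C (Q j i) y z"
    "C y (defect i j, 0) z = C y (P i j) z - C y (Q i j) z - s i j * C y (Q j i) z"
    "C y z (defect i j, 0) = C y z (P i j) - C y z (Q i j) - s i j * C y z (Q j i)"
    if "i < N" "j < N" "y \<in> carrier A" "z \<in> carrier A" for i j y z
  proof -
    note ij = that(1,2)
    have "f (defect i j, 0) = f (P i j) - f (Q i j) - s i j * f (Q j i)"
      if f: "linear_on (carrier A) (scl A) (*) f" for f
    proof -
      have d: "(defect i j, 0) + (Q i j + scl A (s i j) (Q j i)) = P i j"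
        by (simp add: defect_def P_def Q_def s_def A_simps dual_simps(1) fun_scale_zero)
      have sc: "scl A (s i j) (Q j i) \<in> carrier A"
        by (rule w.subspace_scale[OF subspace_carrier[OF superspace_A] cb(3)[OF ij(2,1)]])
      have su: "Q i j + scl A (s i j) (Q j i) \<in> carrier A"
        by (rule w.subspace_add[OF subspace_carrier[OF superspace_A] cb(3)[OF ij] sc])
      have "f (P i j) = f (defect i j, 0) + f (Q i j + scl A (s i j) (Q j i))"
        using f su embed_carrier(1)[OF defect_carrier[OF ij]] unfolding d[symmetric] linear_on_def by blast
      also have "f (Q i j + scl A (s i j) (Q j i)) = f (Q i j) + f (scl A (s i j) (Q j i))"
        using f sc cb(3)[OF ij] unfolding linear_on_def by blast
      also have "f (scl A (s i j) (Q j i)) = s i j * f (Q j i)"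
        using f cb(3)[OF ij(2,1)] unfolding linear_on_def by blast
      finally show ?thesis by (simp only: diff_diff_eq add_diff_cancel_right')
    qed
    then show "C (defect i j, 0) y z = C (P i j) y z - C (Q i j) y z - s i j * C (Q j i) y z"
      "C y (defect i j, 0) z = C y (P i j) z - C y (Q i j) z - s i j * C y (Q j i) z"
      "C y z (defect i j, 0) = C y z (P i j) - C y z (Q i j) - s i j * C y z (Q j i)"
      using C that(3,4) unfolding trilinear_on_def by blast+
  qed
  have "?rhs = (\<Sum>i<N. \<Sum>j<N. (s i j * C (P i j) (G i) (G j) + t i * C (G i) (P i j) (G j)
         + t i * t j * s i j * C (G i) (G j) (P i j))
       - C (Q j i) (G i) (G j) - s i j * C (Q i j) (G i) (G j)
       - t i * s i j * C (G i) (Q j i) (G j)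
       - t i * t j * C (G i) (G j) (Q j i)
       - t i * C (G i) (Q i j) (G j)
       - t i * t j * s i j * C (G i) (G j) (Q i j))"
    unfolding G_def[symmetric] s_def[symmetric] t_def[symmetric]
    using sq by (intro sum.cong refl) (simp add: def ca algebra_simps ss)
  then show ?thesis
    unfolding t_def[symmetric] using dec
    by (simp add: sum_subtractf c1 c2 c3 c4 c5 c6)
qed

text \<open>
  If the equation holds, a trilinear form that reads off a coordinate \<open>f\<close> of the \<open>\<J>\<close>-component in its
  first slot and evaluates the \<open>V\<^sup>*\<close>-components of the other two at \<open>\<beta> e\<^sub>i\<close> and \<open>\<beta> e\<^sub>j\<close> leaves only
  \<open>\<plusminus> f(O(e\<^sub>i, e\<^sub>j))\<close>.
\<close>

lemma solution_iff_defect: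
  "super_HJYBE_solution A skew_tensor \<longleftrightarrow> (\<forall>i<N. \<forall>j<N. defect i j = 0)"
proof -
  define F where "F C i j =
       ksign (par i * par j) * C (defect i j, 0) (0, twisted_dual_e i) (0, twisted_dual_e j)
       + ksign (par i) * C (0, twisted_dual_e i) (defect i j, 0) (0, twisted_dual_e j)
       + ksign (par i) * ksign (par j) * ksign (par i * par j) * C (0, twisted_dual_e i) (0, twisted_dual_e j) (defect i j, 0)"
    for C :: "'j \<times> ('v \<Rightarrow> 'k) \<Rightarrow> 'j \<times> ('v \<Rightarrow> 'k) \<Rightarrow> 'j \<times> ('v \<Rightarrow> 'k) \<Rightarrow> 'k" and i j
  have "super_HJYBE_solution A skew_tensor \<longleftrightarrow>
    (\<forall>C. trilinear_on A (*) C \<longrightarrow> (\<Sum>i<N. \<Sum>j<N. F C i j) = 0)"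
    using super_HJYBE_solution_skew[of A N X par Y, OF A XY_grd, folded skew_tensor_def]
    by (simp only: skew_tensor_twist yang_baxter_contracted F_def simp_thms cong: imp_cong)
  also have "\<dots> \<longleftrightarrow> (\<forall>i<N. \<forall>j<N. defect i j = 0)"
  proof (intro iffI allI impI)
    fix C assume 0: "\<forall>i<N. \<forall>j<N. defect i j = 0" and C: "trilinear_on A (*) C"
    have z: "f (0, 0) = 0" if "linear_on (carrier A) (scl A) (*) f" for f
      using linear_on_zero[OF that subspace_carrier[OF superspace_A]] superspace_A
      by (simp add: superspace_def zero_prod_def)
    have "F C i j = 0" if "i < N" "j < N" for i j
    proof -
      have c: "(0, twisted_dual_e i) \<in> carrier A" "(0, twisted_dual_e j) \<in> carrier A"
        using that twisted_dual_e_carrier embed_carrier(2) by blast+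
      have "linear_on (carrier A) (scl A) (*) (\<lambda>x. C x (0, twisted_dual_e i) (0, twisted_dual_e j))"
        "linear_on (carrier A) (scl A) (*) (\<lambda>x. C (0, twisted_dual_e i) x (0, twisted_dual_e j))"
        "linear_on (carrier A) (scl A) (*) (\<lambda>x. C (0, twisted_dual_e i) (0, twisted_dual_e j) x)"
        using C c unfolding trilinear_on_def by blast+
      note z[OF this(1)] z[OF this(2)] z[OF this(3)]
      moreover have "defect i j = 0" using 0 that by blast
      ultimately show ?thesis unfolding F_def by (simp only: mult_zero_right add_0_left)
    qed
    then show "(\<Sum>i<N. \<Sum>j<N. F C i j) = 0" by simp
  next
    fix i j assume S: "\<forall>C. trilinear_on A (*) C \<longrightarrow> (\<Sum>i<N. \<Sum>j<N. F C i j) = 0" and ij: "i < N" "j < N"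
    obtain BJ where "BJ \<subseteq> carrier J" and BJ: "j.independent BJ" "j.span BJ = carrier J"
      by (rule carrier_basis[OF superspace_J])
    have "j.representation BJ (defect i j) b = 0" for b
    proof -
      define f where "f x = j.representation BJ x b" for x
      define C where "C = (\<lambda>(x :: 'j \<times> ('v \<Rightarrow> 'k)) (y :: 'j \<times> ('v \<Rightarrow> 'k)) (z :: 'j \<times> ('v \<Rightarrow> 'k)).
        f (fst x) * snd y (twist M (e i)) * snd z (twist M (e j)))"
      have f: "linear_on (carrier J) (scl J) (*) f"
        unfolding f_def by (rule linear_on_representation[OF j.vector_space_axioms BJ])
      have f0: "f 0 = 0" unfolding f_def by (simp add: j.representation_zero)
      have "trilinear_on A (*) C"
      proof -
        have f1: "f (fst (x + y)) = f (fst x) + f (fst y)"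
          if "x \<in> carrier A" "y \<in> carrier A" for x y
          using f that unfolding linear_on_def
          by (cases x; cases y; simp only: A_simps mem_Sigma_iff fst_conv add_Pair)
        have f2: "f (fst (scl A c x)) = c * f (fst x)" if "x \<in> carrier A" for x c
          using f that unfolding linear_on_def
          by (cases x; simp only: A_simps mem_Sigma_iff fst_conv)
        have f3: "snd (x + y) w = snd x w + snd y w" "snd (scl A c x) w = c * snd x w" for x y c w
          by (cases x; cases y; simp add: A_simps dual_simps(1) fun_scale_def)+
        show ?thesis
          unfolding trilinear_on_def linear_on_def C_def
          by (intro conjI ballI allI; simp only: f1 f2 f3; simp add: algebra_simps)
      qed
      then have "(\<Sum>k<N. \<Sum>l<N. F C k l) = 0" using S by blast
      moreover have "F C k l = (if l = j then if k = i then ksign (par i * par j) * f (defect i j) else 0 else 0)"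
        if "k < N" "l < N" for k l
        using that ij by (auto simp: F_def C_def f0 twist_dual_twist e_carrier dual_e_e)
      ultimately have "ksign (par i * par j) * f (defect i j) = 0"
        using ij by simp
      then show ?thesis by (simp add: f_def ksign_def split: if_splits)
    qed
    then show "defect i j = 0"
      using j.sum_nonzero_representation_eq[OF BJ(1), of "defect i j"] defect_carrier[OF ij] BJ(2)
      by simp
  qed
  finally show ?thesis .
qed

lemma grd_span: "m.span (e ` {k. k < N \<and> par k = a}) = grd M a"
proof
  have sub: "m.subspace (grd M a)" using superspace_M by (simp add: superspace_def)
  show "m.span (e ` {k. k < N \<and> par k = a}) \<subseteq> grd M a"
    using e_grd by (intro m.span_minimal sub) auto
  show "grd M a \<subseteq> m.span (e ` {k. k < N \<and> par k = a})"
  proof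
    fix w assume w: "w \<in> grd M a"
    have "scl M (dual_e k w) (e k) \<in> m.span (e ` {k. k < N \<and> par k = a})" if k: "k < N" for k
    proof (cases "par k = a")
      case True
      then show ?thesis using k by (intro m.span_scale m.span_base) blast
    next
      case False
      then show ?thesis using dual_e_parity[OF k w] by (simp add: m.span_zero)
    qed
    then have "(\<Sum>k<N. scl M (dual_e k w) (e k)) \<in> m.span (e ` {k. k < N \<and> par k = a})"
      by (intro m.span_sum) simp
    then show "w \<in> m.span (e ` {k. k < N \<and> par k = a})"
      using expand_e[OF carrier_M(1)[OF w]] by simp
  qed
qed

lemma linear_on_subset: "linear_on S s t f \<Longrightarrow> S' \<subseteq> S \<Longrightarrow> linear_on S' s t f"
  unfolding linear_on_def by blast

text \<open>
  For fixed parities \<open>a\<close>, \<open>b\<close> both sides of the defining identity are bilinear, and each homogeneous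
  component is spanned by the basis vectors of its parity.
\<close>

lemma O_operator_iff_defect:
  "O_operator J M T \<longleftrightarrow> (\<forall>i<N. \<forall>j<N. defect i j = 0)"
proof -
  define E where "E u v = prd J (T u) (T v)" for u v
  define R where "R a b u v = T (act M (T u) v + scl M (ksign (a * b)) (act M (T v) u))" for a b u v
  have pJ: "bilinear_on J J (scl J) (prd J)" using J by (simp add: graded_hom_algebra_def)
  have aM: "act M (T u) v \<in> carrier M" if "u \<in> carrier M" "v \<in> carrier M" for u v
    using act_simps(1)[OF T_carrier] that by blast
  have T_add: "u \<in> carrier M \<Longrightarrow> v \<in> carrier M \<Longrightarrow> T (u + v) = T u + T v"
    "u \<in> carrier M \<Longrightarrow> T (scl M c u) = scl J c (T u)" for u v c
    using T_linear by (simp_all add: linear_on_def)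
  have "defect i j = E (e i) (e j) - R (par i) (par j) (e i) (e j)" if "i < N" "j < N" for i j
    using that aM carrier_M(4) by (simp add: defect_def E_def R_def T_act_def T_add e_carrier)
  then have d: "defect i j = 0 \<longleftrightarrow> E (e i) (e j) = R (par i) (par j) (e i) (e j)" if "i < N" "j < N" for i j
    using that by simp
  have lE: "linear_on (carrier M) (scl M) (scl J) (E u)" "linear_on (carrier M) (scl M) (scl J) (\<lambda>v. E v u)"
    if "u \<in> carrier M" for u
    using pJ that T_carrier T_add unfolding bilinear_on_def linear_on_def E_def by simp_all
  have lR: "linear_on (carrier M) (scl M) (scl J) (R a b u)" "linear_on (carrier M) (scl M) (scl J) (\<lambda>v. R a b v u)"
    if "u \<in> carrier M" for u a b
    using that unfolding linear_on_def R_def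
    by (simp_all add: T_add act_simps T_carrier carrier_M aM j.scale_right_distrib algebra_simps)
  have "O_operator J M T \<longleftrightarrow> (\<forall>a b. \<forall>u\<in>grd M a. \<forall>v\<in>grd M b. E u v = R a b u v)"
    using T T_twist by (simp add: O_operator_def E_def R_def)
  also have "\<dots> \<longleftrightarrow> (\<forall>i<N. \<forall>j<N. E (e i) (e j) = R (par i) (par j) (e i) (e j))"
  proof (intro iffI allI impI ballI)
    fix a b u v
    assume h: "\<forall>i<N. \<forall>j<N. E (e i) (e j) = R (par i) (par j) (e i) (e j)"
      and u: "u \<in> grd M a" and v: "v \<in> grd M b"
    have sub: "grd M c \<subseteq> carrier M" for c using carrier_M(1) by blast
    note eq = linear_on_eq_span[OF linear_on_subset[OF _ sub] linear_on_subset[OF _ sub] grd_span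
        m.vector_space_axioms j.vector_space_axioms]
    have 1: "E (e i) v = R a b (e i) v" if i: "i < N" "par i = a" for i
      using h i by (intro eq[OF lE(1)[OF e_carrier[OF i(1)]] lR(1)[OF e_carrier[OF i(1)]] _ v]) auto
    show "E u v = R a b u v"
      using 1 by (intro eq[OF lE(2)[OF carrier_M(1)[OF v]] lR(2)[OF carrier_M(1)[OF v]] _ u]) auto
  qed (use e_grd in blast)
  finally show ?thesis using d by auto
qed

theorem skew_solution_iff_O_operator:
  "super_skew_symmetric A skew_tensor \<and> super_HJYBE_solution A skew_tensor \<longleftrightarrow> O_operator J M T"
  using skew_tensor_skew solution_iff_defect O_operator_iff_defect by blast

end

section \<open>The characterisation of O-operators\<close>

theorem theorem3p7:
  fixes J :: "('k::{alg_closed_field, field_char_0}, 'j::ab_group_add) hom_superalgebra"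
    and M :: "('k, 'j, 'v::ab_group_add) hom_module"
    and T :: "'v \<Rightarrow> 'j"
    and p q :: nat
    and u v :: "nat \<Rightarrow> 'v"
  assumes "hom_jordan_superalgebra J" and "regular J" and "finite_dim J"
    and "hom_jordan_module J M" and "finite_dim M"
    and "bij_betw (twist M) (carrier M) (carrier M)"
    and "even_linear M J T"
    and "\<forall>w\<in>carrier M. T (twist M w) = twist J (T w)"
    and "\<forall>i\<in>{1..p}. u i \<in> grd M 0" and "\<forall>s\<in>{1..q}. v s \<in> grd M 1"
    and "inj_on u {1..p}" and "inj_on v {1..q}"
    and "\<not> module.dependent (scl M) (u ` {1..p} \<union> v ` {1..q})"
    and "module.span (scl M) (u ` {1..p} \<union> v ` {1..q}) = carrier M"
  shows
    "(let A = semidirect J (dual_module J M);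
          B = u ` {1..p} \<union> v ` {1..q};
          t = (\<Sum>i=1..p. tensor2 A (T (u i), 0) (0, dual_vec M B (u i))) +
              (\<Sum>s=1..q. tensor2 A (T (v s), 0) (0, dual_vec M B (v s)));
          r = t - tensor_swap A t
      in super_skew_symmetric A r \<and> super_HJYBE_solution A r)
     \<longleftrightarrow> O_operator J M T"
proof -
  \<comment> \<open>A single enumeration of the basis, the even vectors first; the given families are indexed from 1.\<close>
  define e where "e k = (if k < p then u (Suc k) else v (Suc (k - p)))" for k
  define par :: "nat \<Rightarrow> bit" where "par k = (if k < p then 0 else 1)" for k
  have M: "superspace M" using assms(4) by (simp add: hom_jordan_module_def Let_def)
  interpret m: vector_space "scl M" using M by (simp add: superspace_def)
  have split: "{..<p + q} = {..<p} \<union> {p..<p + q}" by auto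
  have s1: "{1..p} = Suc ` {..<p}"
    by (auto simp: image_Suc_lessThan)
  have s2: "{1..q} = (\<lambda>k. Suc (k - p)) ` {p..<p + q}"
  proof -
    have "s \<in> (\<lambda>k. Suc (k - p)) ` {p..<p + q}" if "s \<in> {1..q}" for s
      using that by (intro image_eqI[of _ _ "p + s - 1"]) auto
    then show ?thesis by auto
  qed
  have e1: "e ` {..<p} = u ` {1..p}"
    unfolding s1 image_image by (intro image_cong) (auto simp: e_def)
  have e2: "e ` {p..<p + q} = v ` {1..q}"
    unfolding s2 image_image by (intro image_cong) (auto simp: e_def)
  have B: "e ` {..<p + q} = u ` {1..p} \<union> v ` {1..q}"
    unfolding split image_Un e1 e2 ..
  have i2: "inj_on (\<lambda>k. Suc (k - p)) {p..<p + q}" by (auto simp: inj_on_def)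
  have "inj_on e {..<p}"
    using assms(11) unfolding s1 by (auto simp: inj_on_def e_def)
  moreover have "inj_on e {p..<p + q}"
    using comp_inj_on[OF i2 assms(12)[unfolded s2]] by (auto simp: inj_on_def e_def)
  \<comment> \<open>A vector that is both even and odd is 0, which an independent set does not contain.\<close>
  moreover have "e ` {..<p} \<inter> e ` {p..<p + q} = {}"
  proof -
    have "False" if x: "x \<in> u ` {1..p}" "x \<in> v ` {1..q}" for x
    proof -
      have "x = 0" using x assms(9,10) M by (auto simp: superspace_def)
      then have "0 \<in> u ` {1..p} \<union> v ` {1..q}" using x(1) by (simp only: UnI1)
      then show False using assms(13) m.dependent_zero by (simp only: simp_thms)
    qed
    then show ?thesis unfolding e1 e2 by (intro equals0I) (simp only: Int_iff, elim conjE)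
  qed
  ultimately have inj: "inj_on e {..<p + q}"
    unfolding split inj_on_Un by (simp only: simp_thms) (rule equals0I, blast)
  have gJ: "graded_hom_algebra J"
    using assms(1) unfolding hom_jordan_superalgebra_def graded_hom_algebra_def by (elim conjE) (intro conjI)
  have gM: "graded_hom_module J M"
    using assms(4) unfolding hom_jordan_module_def graded_hom_module_def Let_def by (elim conjE) (intro conjI)
  have tM: "\<forall>a. \<forall>x\<in>grd J a. \<forall>w\<in>carrier M. twist M (act M x w) = act M (twist J x) (twist M w)"
    using assms(4) unfolding hom_jordan_module_def Let_def by (elim conjE)
  interpret dual_tensor J M T e par "p + q"
  proof (intro dual_tensor.intro dualizable_module.intro dual_tensor_axioms.intro gJ gM assms(6,7) inj)
    show "twist M (act M x w) = act M (twist J x) (twist M w)" if "x \<in> grd J a" "w \<in> carrier M" for a x w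
      using tM that by blast
    show "e k \<in> grd M (par k)" if "k < p + q" for k
      using assms(9,10) that by (auto simp: e_def par_def)
  qed (use assms(8,13,14) in \<open>simp_all only: B not_False_eq_True\<close>)
  have sum: "(\<Sum>k<p + q. f (e k)) = (\<Sum>i=1..p. f (u i)) + (\<Sum>s=1..q. f (v s))"
    for f :: "'v \<Rightarrow> (('j \<times> ('v \<Rightarrow> 'k)) \<Rightarrow> ('j \<times> ('v \<Rightarrow> 'k)) \<Rightarrow> 'k) \<Rightarrow> 'k"
  proof -
    have "(\<Sum>k<p + q. f (e k)) = (\<Sum>k<p. f (e k)) + (\<Sum>k=p..<p + q. f (e k))"
      unfolding split by (rule sum.union_disjoint) auto
    moreover have "(\<Sum>i=1..p. f (u i)) = (\<Sum>k<p. f (e k))"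
      unfolding s1 by (subst sum.reindex) (auto simp: e_def)
    moreover have "(\<Sum>s=1..q. f (v s)) = (\<Sum>k=p..<p + q. f (e k))"
      unfolding s2 by (subst sum.reindex[OF i2]) (auto simp: e_def)
    ultimately show ?thesis by simp
  qed
  show ?thesis
    using skew_solution_iff_O_operator
    unfolding skew_tensor_swap B sum[of "\<lambda>w. tensor2 A (T w, 0) (0, dual_vec M (u ` {1..p} \<union> v ` {1..q}) w)"] Let_def .
qed

end
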